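(* Let $L:S\mathcal E(\mu)\times[0,1]\to\mathbb R$ be a smooth Lagrangian such that, for each $q\in\mathcal E(\mu)$ and each $t$, the fiber gradient mapping $w\mapsto\eta=\mathrm{Grad}_{e}L(q,w,t)$ is a one-to-one mapping from $S_q\mathcal E(\mu)$ onto ${}^*S_q\mathcal E(\mu)$, and such that for each $t$ the map $(q,w)\mapsto(q,\mathrm{Grad}_{e}L(q,w,t))$ is a diffeomorphism $S\mathcal E(\mu)\to{}^*S\mathcal E(\mu)$. Define the Hamiltonian, for $(q,\eta)\in{}^*S\mathcal E(\mu)$, by $$H(q,\eta,t)=\langle\eta,w\rangle_q-L(q,w,t),\qquad w=(\mathrm{Grad}_{e}L(q,\cdot,t))^{-1}(\eta).$$ Let $t\mapsto q(t)\in\mathcal E(\mu)$ be a smooth solution of the Euler–Lagrange equation $$\frac{D}{dt}\,\mathrm{Grad}_{e}L(q(t),\overset{\star}{q}(t),t)=\mathrm{Grad}\,L(q(t),\overset{\star}{q}(t),t),$$ and let $\eta(t)=\mathrm{Grad}_{e}L(q(t),\overset{\star}{q}(t),t)$ be the momentum. Then the momentum curve $t\mapsto(q(t),\eta(t))\in{}^*S\mathcal E(\mu)$ satisfies the Hamilton equations $$\begin{cases}\dfrac{D}{dt}\eta(t)=-\mathrm{Grad}\,H(q(t),\eta(t),t),\\[4pt] \overset{\star}{q}(t)=\mathrm{Grad}_{m}H(q(t),\eta(t),t).\end{cases}$$ Moreover, $$\frac{d}{dt}H(q(t),\eta(t),t)=\frac{\partial}{\partial t}H(q(t),\eta(t),t),$$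 where on the right the partial derivative is with respect to the explicit time variable. Throughout, $\frac{D}{dt}$ is the mixture covariant derivative.
   Context: $\Omega$ is a finite set with $N$ elements and $\mu$ is the uniform probability on $\Omega$. $\mathcal E(\mu)$ is the set of strictly positive probability densities with respect to $\mu$, i.e. functions $q:\Omega\to(0,\infty)$ with $\sum_{x}q(x)=N$. For $f:\Omega\to\mathbb R$, $\mathbb E_q[f]=\frac1N\sum_x f(x)q(x)$. For $q\in\mathcal E(\mu)$ the exponential fiber $S_q\mathcal E(\mu)$ and the mixture fiber ${}^*S_q\mathcal E(\mu)$ are both equal, as vector spaces, to $\{v:\Omega\to\mathbb R : \mathbb E_q[v]=0\}$, with duality pairing $\langle\eta,v\rangle_q=\mathbb E_q[\eta v]$ for $\eta\in{}^*S_q\mathcal E(\mu)$, $v\in S_q\mathcal E(\mu)$. The bundles are $S\mathcal E(\mu)=\{(q,w):q\in\mathcal E(\mu),w\in S_q\mathcal E(\mu)\}$ and ${}^*S\mathcal E(\mu)=\{(q,\eta):q\in\mathcal E(\mu),\eta\in{}^*S_q\mathcal E(\mu)\}$, with the manifold structure induced from $\mathbb R^{2N}$. The exponential transport is ${}^{e}\mathbb U_p^q v=v-\mathbb E_q[v]$ from $S_p\mathcal E(\mu)$ to $S_q\mathcal E(\mu)$; the mixture transport is ${}^{m}\mathbb U_p^q\eta=\frac pq\,\eta$ from ${}^*S_p\mathcal E(\mu)$ to ${}^*S_q\mathcal E(\mu)$. For $p\in\mathcal E(\mu)$ and $u\in S_p\mathcal E(\mu)$, $K_p(u)=\log\mathbb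 E_p[e^u]$ and $e_p(u)=e^{u-K_p(u)}\,p$; $e_p$ is a bijection $S_p\mathcal E(\mu)\to\mathcal E(\mu)$. A dot denotes the ordinary time derivative. The velocity of a smooth curve $q(t)$ in $\mathcal E(\mu)$ is $\overset{\star}{q}(t)=\dot q(t)/q(t)\in S_{q(t)}\mathcal E(\mu)$. The mixture covariant derivative of $\eta(t)\in{}^*S_{q(t)}\mathcal E(\mu)$ along $q(t)$ is $\frac{D}{dt}\eta=\overset{\star}{q}\,\eta+\dot\eta$. Gradients of $L$: the fiber gradient $\mathrm{Grad}_{e}L(q,w,t)\in{}^*S_q\mathcal E(\mu)$ is defined by $\frac{d}{ds}L(q,w+s\beta,t)|_{s=0}=\langle\mathrm{Grad}_{e}L(q,w,t),\beta\rangle_q$ for all $\beta\in S_q\mathcal E(\mu)$. The gradient $\mathrm{Grad}\,L(q,w,t)\in{}^*S_q\mathcal E(\mu)$ satisfies, for any $p$, with $L_p(u,v,t)=L(e_p(u),{}^{e}\mathbb U_p^{e_p(u)}v,t)$, $q=e_p(u)$, $w={}^{e}\mathbb U_p^q v$: $\langle\mathrm{Grad}\,L(q,w,t),h\rangle_q=D_1L_p(u,v,t)[{}^{e}\mathbb U_q^p h]$ for all $h\in S_q\mathcal E(\mu)$. Gradients of $H$: the fiber gradient $\mathrm{Grad}_{m}H(q,\eta,t)\in S_q\mathcal E(\mu)$ is defined by $\frac{d}{ds}H(q,\eta+s\alpha,t)|_{s=0}=\langle\alpha,\mathrm{Grad}_{m}H(q,\eta,t)\rangle_q$ for all $\alpha\in{}^*S_q\mathcal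 E(\mu)$. The gradient $\mathrm{Grad}\,H(q,\eta,t)\in{}^*S_q\mathcal E(\mu)$ satisfies, for any $p$, with $H_p(u,\zeta,t)=H(e_p(u),{}^{m}\mathbb U_p^{e_p(u)}\zeta,t)$, $q=e_p(u)$, $\eta={}^{m}\mathbb U_p^q\zeta$: $\langle\mathrm{Grad}\,H(q,\eta,t),h\rangle_q=D_1H_p(u,\zeta,t)[{}^{e}\mathbb U_q^p h]$ for all $h\in S_q\mathcal E(\mu)$. Here $D_1$ is the differential in the first variable $u$. *)

theory Defs
  imports "HOL-Analysis.Analysis"
begin

text \<open>
  The sample space is the finite type \<open>'n\<close>, so \<open>N = CARD('n)\<close> and functions on the sample
  space are vectors in \<open>real ^ 'n\<close>; densities are taken with respect to the uniform probability.
\<close>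

subsection \<open>Smoothness on subsets of Euclidean spaces\<close>

primrec Ck_on ::
  "nat \<Rightarrow> ('a::euclidean_space \<Rightarrow> 'b::real_normed_vector) \<Rightarrow> 'a set \<Rightarrow> bool" where
  "Ck_on 0 f U \<longleftrightarrow> continuous_on U f"
| "Ck_on (Suc k) f U \<longleftrightarrow> (\<forall>x\<in>U. f differentiable at x) \<and>
     (\<forall>v. Ck_on k (\<lambda>x. frechet_derivative f (at x) v) U)"

text \<open>
  A map on an arbitrary subset is smooth if it extends, locally around every point of the subset,
  to a \<open>C\<^sup>\<infinity>\<close> map on an open set of the ambient space. On an embedded submanifold (with
  boundary) this is smoothness for the induced manifold structure.
\<close>

definition smooth_on :: "'a::euclidean_space set \<Rightarrow> ('a \<Rightarrow> 'b::real_normed_vector) \<Rightarrow> bool" where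
  "smooth_on M f \<longleftrightarrow> (\<forall>x\<in>M. \<exists>U g. open U \<and> x \<in> U \<and> (\<forall>k. Ck_on k g U) \<and>
     (\<forall>y\<in>M \<inter> U. f y = g y))"

definition diffeomorphism_on ::
  "'a::euclidean_space set \<Rightarrow> 'b::euclidean_space set \<Rightarrow> ('a \<Rightarrow> 'b) \<Rightarrow> bool" where
  "diffeomorphism_on M M' f \<longleftrightarrow>
     bij_betw f M M' \<and> smooth_on M f \<and> smooth_on M' (inv_into M f)"

subsection \<open>Densities, fibers and bundles\<close>

definition densities :: "(real ^ 'n::finite) set" where
  "densities = {q. (\<forall>x. q $ x > 0) \<and> (\<Sum>x\<in>UNIV. q $ x) = real CARD('n)}"

definition expect :: "real ^ 'n::finite \<Rightarrow> real ^ 'n \<Rightarrow> real" where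
  "expect q f = (1 / real CARD('n)) * (\<Sum>x\<in>UNIV. f $ x * q $ x)"

definition exp_fiber :: "real ^ 'n::finite \<Rightarrow> (real ^ 'n) set" where
  "exp_fiber q = {v. expect q v = 0}"

definition mix_fiber :: "real ^ 'n::finite \<Rightarrow> (real ^ 'n) set" where
  "mix_fiber q = {\<eta>. expect q \<eta> = 0}"

definition pairing :: "real ^ 'n::finite \<Rightarrow> real ^ 'n \<Rightarrow> real ^ 'n \<Rightarrow> real" where
  "pairing q \<eta> v = expect q (\<chi> x. \<eta> $ x * v $ x)"

definition exp_bundle :: "((real ^ 'n::finite) \<times> (real ^ 'n)) set" where
  "exp_bundle = {(q, w). q \<in> densities \<and> w \<in> exp_fiber q}"

definition mix_bundle :: "((real ^ 'n::finite) \<times> (real ^ 'n)) set" where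
  "mix_bundle = {(q, \<eta>). q \<in> densities \<and> \<eta> \<in> mix_fiber q}"

text \<open>In both transports the first density is the source and the second one the target.\<close>

definition exp_transport :: "real ^ 'n::finite \<Rightarrow> real ^ 'n \<Rightarrow> real ^ 'n \<Rightarrow> real ^ 'n" where
  "exp_transport p q v = (\<chi> x. v $ x - expect q v)"

definition mix_transport :: "real ^ 'n::finite \<Rightarrow> real ^ 'n \<Rightarrow> real ^ 'n \<Rightarrow> real ^ 'n" where
  "mix_transport p q \<eta> = (\<chi> x. p $ x / q $ x * \<eta> $ x)"

definition cumulant :: "real ^ 'n::finite \<Rightarrow> real ^ 'n \<Rightarrow> real" where
  "cumulant p u = ln (expect p (\<chi> x. exp (u $ x)))"

definition exp_chart_inv :: "real ^ 'n::finite \<Rightarrow> real ^ 'n \<Rightarrow> real ^ 'n" where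
  "exp_chart_inv p u = (\<chi> x. exp (u $ x - cumulant p u) * p $ x)"

subsection \<open>Velocity and mixture covariant derivative\<close>

text \<open>
  Curves are parametrised by a real interval \<open>J\<close>; time derivatives are taken within \<open>J\<close>,
  i.e. one-sided at those end points that belong to \<open>J\<close>.
\<close>

definition velocity :: "real set \<Rightarrow> (real \<Rightarrow> real ^ 'n::finite) \<Rightarrow> real \<Rightarrow> real ^ 'n" where
  "velocity J q t = (\<chi> x. vector_derivative q (at t within J) $ x / q t $ x)"

definition mix_covariant_derivative ::
  "real set \<Rightarrow> (real \<Rightarrow> real ^ 'n::finite) \<Rightarrow> (real \<Rightarrow> real ^ 'n) \<Rightarrow> real \<Rightarrow> real ^ 'n" where
  "mix_covariant_derivative J q \<eta> t =
     (\<chi> x. velocity J q t $ x * \<eta> t $ x) + vector_derivative \<eta> (at t within J)"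

subsection \<open>Gradients\<close>

text \<open>
  Each gradient is first given by its defining property and then selected by \<open>THE\<close>. The
  differential in the first variable is the Frechet derivative within the fiber at \<open>p\<close>; it is
  evaluated only at vectors of that fiber, on which it is uniquely determined.
\<close>

type_synonym 'n bundle_fun = "real ^ 'n \<Rightarrow> real ^ 'n \<Rightarrow> real \<Rightarrow> real"

definition is_fiber_grad_e ::
  "'n::finite bundle_fun \<Rightarrow> real ^ 'n \<Rightarrow> real ^ 'n \<Rightarrow> real \<Rightarrow> real ^ 'n \<Rightarrow> bool" where
  "is_fiber_grad_e L q w t g \<longleftrightarrow> g \<in> mix_fiber q \<and>
     (\<forall>\<beta>\<in>exp_fiber q. ((\<lambda>s. L q (w + s *\<^sub>R \<beta>) t) has_real_derivative pairing q g \<beta>) (at 0))"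

definition fiber_grad_e ::
  "'n::finite bundle_fun \<Rightarrow> real ^ 'n \<Rightarrow> real ^ 'n \<Rightarrow> real \<Rightarrow> real ^ 'n" where
  "fiber_grad_e L q w t = (THE g. is_fiber_grad_e L q w t g)"

definition is_fiber_grad_m ::
  "'n::finite bundle_fun \<Rightarrow> real ^ 'n \<Rightarrow> real ^ 'n \<Rightarrow> real \<Rightarrow> real ^ 'n \<Rightarrow> bool" where
  "is_fiber_grad_m H q \<eta> t g \<longleftrightarrow> g \<in> exp_fiber q \<and>
     (\<forall>\<alpha>\<in>mix_fiber q. ((\<lambda>s. H q (\<eta> + s *\<^sub>R \<alpha>) t) has_real_derivative pairing q \<alpha> g) (at 0))"

definition fiber_grad_m ::
  "'n::finite bundle_fun \<Rightarrow> real ^ 'n \<Rightarrow> real ^ 'n \<Rightarrow> real \<Rightarrow> real ^ 'n" where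
  "fiber_grad_m H q \<eta> t = (THE g. is_fiber_grad_m H q \<eta> t g)"

definition is_grad_exp ::
  "'n::finite bundle_fun \<Rightarrow> real ^ 'n \<Rightarrow> real ^ 'n \<Rightarrow> real \<Rightarrow> real ^ 'n \<Rightarrow> bool" where
  "is_grad_exp L q w t g \<longleftrightarrow> g \<in> mix_fiber q \<and>
     (\<forall>p\<in>densities. \<forall>u\<in>exp_fiber p. \<forall>v\<in>exp_fiber p.
        q = exp_chart_inv p u \<longrightarrow> w = exp_transport p q v \<longrightarrow>
        (\<exists>D. ((\<lambda>u'. L (exp_chart_inv p u') (exp_transport p (exp_chart_inv p u') v) t)
                has_derivative D) (at u within exp_fiber p) \<and>
             (\<forall>h\<in>exp_fiber q. pairing q g h = D (exp_transport q p h))))"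

definition grad_exp ::
  "'n::finite bundle_fun \<Rightarrow> real ^ 'n \<Rightarrow> real ^ 'n \<Rightarrow> real \<Rightarrow> real ^ 'n" where
  "grad_exp L q w t = (THE g. is_grad_exp L q w t g)"

definition is_grad_mix ::
  "'n::finite bundle_fun \<Rightarrow> real ^ 'n \<Rightarrow> real ^ 'n \<Rightarrow> real \<Rightarrow> real ^ 'n \<Rightarrow> bool" where
  "is_grad_mix H q \<eta> t g \<longleftrightarrow> g \<in> mix_fiber q \<and>
     (\<forall>p\<in>densities. \<forall>u\<in>exp_fiber p. \<forall>\<zeta>\<in>mix_fiber p.
        q = exp_chart_inv p u \<longrightarrow> \<eta> = mix_transport p q \<zeta> \<longrightarrow>
        (\<exists>D. ((\<lambda>u'. H (exp_chart_inv p u') (mix_transport p (exp_chart_inv p u') \<zeta>) t)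
                has_derivative D) (at u within exp_fiber p) \<and>
             (\<forall>h\<in>exp_fiber q. pairing q g h = D (exp_transport q p h))))"

definition grad_mix ::
  "'n::finite bundle_fun \<Rightarrow> real ^ 'n \<Rightarrow> real ^ 'n \<Rightarrow> real \<Rightarrow> real ^ 'n" where
  "grad_mix H q \<eta> t = (THE g. is_grad_mix H q \<eta> t g)"

subsection \<open>Hamiltonian\<close>

definition hamiltonian :: "'n::finite bundle_fun \<Rightarrow> 'n bundle_fun" where
  "hamiltonian L q \<eta> t =
     (let w = inv_into (exp_fiber q) (\<lambda>w. fiber_grad_e L q w t) \<eta>
      in pairing q \<eta> w - L q w t)"

end

theory Submission
  imports Defs
begin

text \<open>
  The Hamiltonian is a Legendre transform, and its differential is computed by the envelope
  principle. Write \<open>w = legendre_inv q \<eta> t\<close> for the velocity with momentum \<open>\<eta>\<close>. It is a critical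
  point, along the fiber at \<open>q\<close>, of \<open>v \<mapsto> \<langle>\<eta>, v\<rangle> - L q v t\<close>, and \<open>H\<close> is the critical value. Hence moving \<open>w\<close>
  does not contribute to the differential of \<open>H\<close>, which is that of the same expression with \<open>w\<close>
  merely transported to the nearby fibers (\<open>hamiltonian_has_derivative\<close>). Reading this differential
  in the three kinds of direction gives everything: along the fiber it is the pairing with \<open>w\<close>, so
  the fiber gradient of \<open>H\<close> is \<open>w\<close>; along the chart the mixture transport keeps \<open>\<eta> * q\<close> constant, so
  only the variation of \<open>- L\<close> remains and \<open>Grad H = - Grad L\<close>; in time it is \<open>- \<partial>\<^sub>t L\<close>. The
  Euler--Lagrange equation then turns into the first Hamilton equation. Along the solution, the
  covariant derivative of \<open>\<eta>\<close> is the rate of change of \<open>\<eta> * q\<close> relative to \<open>q\<close>, and the terms other than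
  \<open>- \<partial>\<^sub>t L\<close> in the derivative of \<open>H\<close> cancel by the Euler--Lagrange equation paired with the velocity.
  
  The envelope argument needs a bound on how fast \<open>w\<close> moves, jointly in \<open>q\<close>, \<open>\<eta>\<close> and \<open>t\<close>, whereas the
  Legendre map is a diffeomorphism for each single time only. The bound is obtained without
  differentiating the implicit equation in time: with the inverse at the base time \<open>t0\<close>, the equation
  \<open>Grad\<^sub>e L q w t = \<eta>\<close> becomes a fixed point equation for \<open>w\<close>, and Brouwer's theorem produces a
  solution in a ball whose radius is proportional to the displacement of \<open>(q, \<eta>, t)\<close>
  (\<open>legendre_inv_lipschitz_at\<close>). Uniqueness in the fiber identifies it with \<open>legendre_inv q \<eta> t\<close>.
  
  Smooth functions on the bundles are handled through derivatives within the bundle. Such a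
  derivative is not determined in directions transversal to the bundle, but every formula below is
  valid for any choice of it.
\<close>

section \<open>Expectation and the duality pairing\<close>

lemma expect_commute: "expect q f = expect f q"
  by (simp add: expect_def mult.commute)

interpretation expect: bounded_bilinear "expect :: real ^ 'n::finite \<Rightarrow> _"
  by (subst bilinear_conv_bounded_bilinear [symmetric])
     (auto simp: bilinear_def expect_def algebra_simps sum.distrib sum_distrib_left
           add_divide_distrib intro!: linearI)

interpretation vec_times: bounded_bilinear "(*) :: real ^ 'n::finite \<Rightarrow> real ^ 'n \<Rightarrow> real ^ 'n"
  by (subst bilinear_conv_bounded_bilinear [symmetric])
     (auto simp: bilinear_def vec_eq_iff algebra_simps intro!: linearI)

lemma pairing_eq_expect: "pairing q \<eta> v = expect (\<eta> * q) v"
  by (simp add: pairing_def expect_def mult_ac)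

lemma expect_one: "q \<in> densities \<Longrightarrow> expect q 1 = 1"
  by (simp add: densities_def expect_def)

lemma expect_times_move: "expect (a * b) c = expect a (b * c)"
  by (simp add: expect_def mult_ac)

lemma densities_pos: "q \<in> densities \<Longrightarrow> 0 < q $ x"
  and densities_nonzero: "q \<in> densities \<Longrightarrow> q $ x \<noteq> 0"
  by (auto simp: densities_def less_le)

lemma exp_fiber_subspace: "subspace (exp_fiber q)"
  by (auto simp: subspace_def exp_fiber_def expect.zero_right expect.add_right expect.scaleR_right)

lemma mix_fiber_eq_exp_fiber: "mix_fiber q = exp_fiber q"
  by (simp add: mix_fiber_def exp_fiber_def)

lemma exp_transport_eq: "exp_transport p q v = v - expect q v *\<^sub>R 1"
  by (simp add: exp_transport_def vec_eq_iff)

lemma exp_transport_in_fiber: "q \<in> densities \<Longrightarrow> exp_transport p q v \<in> exp_fiber q"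
  by (simp add: exp_fiber_def exp_transport_eq expect.diff_right expect.scaleR_right expect_one)

text \<open>
  The difference of two representatives lies in the fiber and may be paired with itself, which gives
  a weighted sum of squares with strictly positive weights.
\<close>

lemma pairing_eq_imp_eq:
  assumes q: "q \<in> densities" and g: "g \<in> mix_fiber q" "g' \<in> mix_fiber q"
    and eq: "\<And>h. h \<in> exp_fiber q \<Longrightarrow> pairing q g h = pairing q g' h"
  shows "g = g'"
proof -
  have "g - g' \<in> exp_fiber q"
    using g by (simp add: mix_fiber_eq_exp_fiber subspace_diff [OF exp_fiber_subspace])
  from eq [OF this] have "expect ((g - g') * q) (g - g') = 0"
    by (simp add: pairing_eq_expect vec_times.diff_left expect.diff_left)
  then have "(\<Sum>x\<in>UNIV. q $ x * (g $ x - g' $ x)\<^sup>2) = 0"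
    by (simp add: expect_def power2_eq_square mult_ac)
  then have "\<forall>x\<in>UNIV. q $ x * (g $ x - g' $ x)\<^sup>2 = 0"
    using densities_pos [OF q] by (subst (asm) sum_nonneg_eq_0_iff) (auto simp: less_imp_le)
  then show ?thesis
    using densities_nonzero [OF q] by (simp add: vec_eq_iff)
qed

text \<open>
  The element of the fiber at \<open>q\<close> that represents, for the pairing at \<open>q\<close>, the restriction to the
  fiber of \<open>h \<mapsto> \<Sum>\<^sub>x c\<^sub>x h\<^sub>x\<close>. The density \<open>N c / q\<close> of this functional is corrected by the constant
  that makes its mean zero; constants pair to zero with the fiber.
\<close>

definition riesz :: "real ^ 'n::finite \<Rightarrow> real ^ 'n \<Rightarrow> real ^ 'n" where
  "riesz q c = (\<chi> x. real CARD('n) * c $ x / q $ x - (\<Sum>y\<in>UNIV. c $ y))"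

lemma riesz_in_fiber:
  fixes q :: "real ^ 'n::finite"
  assumes "q \<in> densities" shows "riesz q c \<in> mix_fiber q"
proof -
  have "(\<Sum>x\<in>UNIV. riesz q c $ x * q $ x) =
      (\<Sum>x\<in>UNIV. real CARD('n) * c $ x - (\<Sum>y\<in>UNIV. c $ y) * q $ x)"
    using densities_nonzero [OF assms] by (intro sum.cong) (auto simp: riesz_def left_diff_distrib)
  also have "\<dots> = 0"
    using assms by (simp add: sum_subtractf densities_def flip: sum_distrib_left)
  finally show ?thesis
    by (simp add: mix_fiber_def expect_def)
qed

lemma pairing_riesz:
  fixes q :: "real ^ 'n::finite"
  assumes q: "q \<in> densities" and l: "linear l" and h: "h \<in> exp_fiber q"
  shows "pairing q (riesz q (\<chi> x. l (axis x 1))) h = l h"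
proof -
  have "(\<Sum>x\<in>UNIV. h $ x * q $ x) = 0"
    using h by (simp add: exp_fiber_def expect_def)
  moreover have "l h = (\<Sum>x\<in>UNIV. h $ x * l (axis x 1))"
  proof -
    have "l h = l (\<Sum>x\<in>UNIV. h $ x *\<^sub>R axis x 1)"
      by (simp add: basis_expansion flip: scalar_mult_eq_scaleR)
    then show ?thesis
      by (simp add: linear_sum [OF l] linear_cmul [OF l])
  qed
  moreover have "riesz q (\<chi> x. l (axis x 1)) $ x * h $ x * q $ x =
      real CARD('n) * (h $ x * l (axis x 1)) - (\<Sum>y\<in>UNIV. l (axis y 1)) * (h $ x * q $ x)" for x
    using densities_nonzero [OF q, of x] by (simp add: riesz_def divide_simps) (simp add: algebra_simps)
  ultimately show ?thesis
    by (simp add: pairing_def expect_def sum_subtractf flip: sum_distrib_left)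
qed

lemma expect_mix_fiber_times_one: "\<eta> \<in> mix_fiber q \<Longrightarrow> expect (\<eta> * q) 1 = 0"
  by (simp add: mix_fiber_def expect_times_move expect_commute [of \<eta>])

lemma mix_transport_in_fiber:
  fixes q \<zeta> :: "real ^ 'm::finite"
  assumes "q \<in> densities" "\<zeta> \<in> mix_fiber p"
  shows "mix_transport p q \<zeta> \<in> mix_fiber q"
  using assms(2) densities_nonzero [OF assms(1)]
  by (simp add: mix_fiber_def expect_def mix_transport_def mult.commute)

lemma exp_transport_lipschitz_at:
  assumes "w \<in> exp_fiber p"
  obtains B where "0 \<le> B" "\<And>q. norm (exp_transport p q w - w) \<le> B * norm (q - p)"
proof -
  obtain C where C: "0 \<le> C" "\<And>a. norm (expect a w) \<le> norm a * C"
    using bounded_linear.nonneg_bounded [OF expect.bounded_linear_left] by metis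
  have "norm (exp_transport p q w - w) \<le> (C * norm (1 :: real ^ 'a)) * norm (q - p)" for q
  proof -
    have "exp_transport p q w - w = - expect (q - p) w *\<^sub>R 1"
      using assms by (simp add: exp_transport_eq exp_fiber_def expect.diff_left)
    then have "norm (exp_transport p q w - w) = norm (expect (q - p) w) * norm (1 :: real ^ 'a)"
      by simp
    also have "\<dots> \<le> (norm (q - p) * C) * norm (1 :: real ^ 'a)"
      by (intro mult_right_mono C) auto
    finally show ?thesis
      by (simp add: mult_ac)
  qed
  then show thesis
    using C(1) by (intro that [of "C * norm (1 :: real ^ 'a)"]) auto
qed

text \<open>
  The constant may be chosen uniformly for base points near \<open>q0\<close>; the estimate for the Hamiltonian
  involves the pairings of all nearby fibers at once.
\<close>

lemma pairing_bounded:
  fixes q0 :: "real ^ 'm::finite"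
  obtains C where "0 \<le> C" "\<And>q \<eta> v. norm (q - q0) \<le> 1 \<Longrightarrow> \<bar>pairing q \<eta> v\<bar> \<le> C * norm \<eta> * norm v"
proof -
  obtain A where A: "0 \<le> A" "\<And>a b :: real ^ 'm. norm (expect a b) \<le> norm a * norm b * A"
    using expect.nonneg_bounded by metis
  obtain B where B: "0 \<le> B" "\<And>a b :: real ^ 'm. norm (a * b) \<le> norm a * norm b * B"
    using vec_times.nonneg_bounded by metis
  have "\<bar>pairing q \<eta> v\<bar> \<le> A * B * (norm q0 + 1) * norm \<eta> * norm v"
    if "norm (q - q0) \<le> 1" for q \<eta> v :: "real ^ 'm"
  proof -
    have q: "norm q \<le> norm q0 + 1"
      using that norm_triangle_ineq [of "q - q0" q0] by simp
    have "\<bar>pairing q \<eta> v\<bar> \<le> norm (\<eta> * q) * norm v * A"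
      using A(2) [of "\<eta> * q" v] by (simp add: pairing_eq_expect)
    also have "\<dots> \<le> (norm \<eta> * (norm q0 + 1) * B) * norm v * A"
      using A(1) B(1) by (intro mult_right_mono order_trans [OF B(2)] mult_left_mono q) auto
    finally show ?thesis
      by (simp add: mult_ac)
  qed
  then show thesis
    using A(1) B(1) by (intro that [of "A * B * (norm q0 + 1)"]) auto
qed

section \<open>Derivatives of maps defined on subsets\<close>

lemma has_derivative_vecI:
  fixes f :: "'a::real_normed_vector \<Rightarrow> real ^ 'n::finite"
  assumes "\<And>i. ((\<lambda>x. f x $ i) has_derivative (\<lambda>h. f' h $ i)) (at a within S)"
  shows "(f has_derivative f') (at a within S)"
  using assms
  by (subst has_derivative_componentwise_within)
     (auto simp: Basis_vec_def inner_axis)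

lemma differentiable_vecI:
  fixes f :: "'a::real_normed_vector \<Rightarrow> real ^ 'n::finite"
  assumes "\<And>i. (\<lambda>x. f x $ i) differentiable (at a within S)"
  shows "f differentiable (at a within S)"
  using assms
  by (subst differentiable_componentwise_within) (auto simp: Basis_vec_def inner_axis)

lemma has_derivative_transform_Int:
  assumes "(g has_derivative D) (at x within S)" "open U" "x \<in> U" "x \<in> S"
    and "\<forall>y\<in>S \<inter> U. f y = g y"
  shows "(f has_derivative D) (at x within S)"
  using assms(1)
  by (rule has_derivative_transform_eventually)
     (use assms in \<open>auto simp: eventually_at_topological\<close>)

lemma smooth_on_has_derivative:
  assumes "smooth_on M f" "x \<in> M"
  obtains D where "(f has_derivative D) (at x within M)"
proof -
  obtain U g where U: "open U" "x \<in> U" "Ck_on 1 g U" "\<forall>y\<in>M \<inter> U. f y = g y"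
    using assms unfolding smooth_on_def by meson
  then have "g differentiable at x"
    by simp
  then obtain D where "(g has_derivative D) (at x)"
    by (auto simp: differentiable_def)
  then have "(g has_derivative D) (at x within M)"
    by (rule has_derivative_at_withinI)
  then have "(f has_derivative D) (at x within M)"
    by (rule has_derivative_transform_Int [OF _ U(1,2) assms(2) U(4)])
  then show thesis ..
qed

lemma smooth_on_imp_continuous_on: "smooth_on M f \<Longrightarrow> continuous_on M f"
  unfolding continuous_on_eq_continuous_within
  by (blast elim: smooth_on_has_derivative intro: has_derivative_continuous)

lemma has_derivative_chain_within:
  assumes "(g has_derivative g') (at (f x) within T)" "(f has_derivative f') (at x within S)"
    and "f ` S \<subseteq> T"
  shows "((\<lambda>x. g (f x)) has_derivative (\<lambda>h. g' (f' h))) (at x within S)"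
  using assms by (blast intro: has_derivative_in_compose [OF assms(2)] has_derivative_subset)

text \<open>
  Although derivatives within a proper subspace are not unique, they agree on the directions of the
  subspace, because they can be tested on lines.
\<close>

lemma has_derivative_unique_along_subspace:
  assumes "subspace S" "u \<in> S" "h \<in> S"
    and "(f has_derivative D) (at u within S)" "(f has_derivative D') (at u within S)"
  shows "D h = D' h"
proof -
  have *: "((\<lambda>s. f (u + s *\<^sub>R h)) has_derivative (\<lambda>s. E (s *\<^sub>R h))) (at 0)"
    if "(f has_derivative E) (at u within S)" for E
  proof (rule has_derivative_chain_within [where T = S])
    show "(f has_derivative E) (at (u + 0 *\<^sub>R h) within S)"
      using that by simp
    show "((\<lambda>s. u + s *\<^sub>R h) has_derivative (\<lambda>s. s *\<^sub>R h)) (at 0)"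
      by (auto intro!: derivative_eq_intros)
    show "range (\<lambda>s. u + s *\<^sub>R h) \<subseteq> S"
      using assms(1-3) by (auto intro: subspace_add subspace_scale)
  qed
  from has_derivative_unique [OF * * , OF assms(4,5)] show ?thesis
    by (auto dest: fun_cong [where x = 1])
qed

lemma has_derivative_imp_lipschitz_at:
  assumes "(f has_derivative D) (at x within S)"
  obtains B d where "0 \<le> B" "0 < d"
    "\<And>y. y \<in> S \<Longrightarrow> norm (y - x) < d \<Longrightarrow> norm (f y - f x) \<le> B * norm (y - x)"
proof -
  have D: "bounded_linear D"
    using assms by (rule has_derivative_bounded_linear)
  then obtain B where B: "0 \<le> B" "\<And>y. norm (D y) \<le> norm y * B"
    using bounded_linear.nonneg_bounded by metis
  obtain d where d: "0 < d"
    "\<And>y. y \<in> S \<Longrightarrow> norm (y - x) < d \<Longrightarrow> norm (f y - f x - D (y - x)) \<le> 1 * norm (y - x)"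
    using assms unfolding has_derivative_within_alt by (meson zero_less_one)
  have "norm (f y - f x) \<le> (B + 1) * norm (y - x)" if "y \<in> S" "norm (y - x) < d" for y
  proof -
    have "norm (f y - f x) \<le> norm (f y - f x - D (y - x)) + norm (D (y - x))"
      using norm_triangle_ineq [of "f y - f x - D (y - x)" "D (y - x)"] by simp
    then show ?thesis
      using d(2) [OF that] B(2) [of "y - x"] by (simp add: algebra_simps)
  qed
  with B(1) d(1) show thesis
    by (intro that [of "B + 1" d]) auto
qed

text \<open>
  An error that is of smaller order than the displacement does not affect the derivative. This is
  how the motion of the critical velocity disappears from the differential of the Hamiltonian.
\<close>

lemma has_derivative_perturb:
  assumes K: "(K has_derivative D) (at x within S)" and x: "x \<in> S"
    and close: "\<And>e. 0 < e \<Longrightarrow> \<exists>d>0. \<forall>y\<in>S. norm (y - x) < d \<longrightarrow> norm (H y - K y) \<le> e * norm (y - x)"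
  shows "(H has_derivative D) (at x within S)"
  unfolding has_derivative_within_alt
proof (intro conjI allI impI)
  show "bounded_linear D"
    using K by (rule has_derivative_bounded_linear)
  have eq: "H x = K x"
    using close [of 1] x by auto
  fix e :: real assume "0 < e"
  then have "0 < e / 2" by simp
  obtain d1 where d1: "0 < d1" "\<And>y. y \<in> S \<Longrightarrow> norm (y - x) < d1 \<Longrightarrow> norm (H y - K y) \<le> e / 2 * norm (y - x)"
    using close [OF \<open>0 < e / 2\<close>] by blast
  obtain d2 where d2: "0 < d2"
    "\<And>y. y \<in> S \<Longrightarrow> norm (y - x) < d2 \<Longrightarrow> norm (K y - K x - D (y - x)) \<le> e / 2 * norm (y - x)"
    using K \<open>0 < e / 2\<close> unfolding has_derivative_within_alt by meson
  have "norm (H y - H x - D (y - x)) \<le> e * norm (y - x)"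
    if "y \<in> S" "norm (y - x) < min d1 d2" for y
  proof -
    have "norm (H y - H x - D (y - x)) \<le> norm (H y - K y) + norm (K y - K x - D (y - x))"
      using norm_triangle_ineq [of "H y - K y" "K y - K x - D (y - x)"] by (simp add: eq algebra_simps)
    then show ?thesis
      using d1(2) [of y] d2(2) [of y] that by simp
  qed
  then show "\<exists>d>0. \<forall>y\<in>S. norm (y - x) < d \<longrightarrow> norm (H y - H x - D (y - x)) \<le> e * norm (y - x)"
    using d1(1) d2(1) by (intro exI [of _ "min d1 d2"]) auto
qed

section \<open>The exponential chart and gradients read in it\<close>

lemma expect_exp_pos:
  assumes "p \<in> densities" shows "0 < expect p (\<chi> x. exp (u $ x))"
  using assms densities_pos [OF assms] by (auto simp: expect_def intro!: sum_pos divide_pos_pos)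

lemma exp_chart_inv_component:
  assumes "p \<in> densities"
  shows "exp_chart_inv p u $ x = exp (u $ x) * p $ x / expect p (\<chi> x. exp (u $ x))"
  using expect_exp_pos [OF assms, of u] by (simp add: exp_chart_inv_def cumulant_def exp_diff)

lemma exp_chart_inv_in_densities:
  fixes p :: "real ^ 'n::finite"
  assumes "p \<in> densities" shows "exp_chart_inv p u \<in> densities"
proof -
  let ?Z = "expect p (\<chi> x. exp (u $ x))"
  have "(\<Sum>x\<in>UNIV. exp (u $ x) * p $ x) = real CARD('n) * ?Z"
    by (simp add: expect_def)
  then have "(\<Sum>x\<in>UNIV. exp (u $ x) * p $ x / ?Z) = real CARD('n)"
    using expect_exp_pos [OF assms, of u] by (simp flip: sum_divide_distrib)
  then show ?thesis
    using expect_exp_pos [OF assms, of u] densities_pos [OF assms]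
    by (simp add: densities_def exp_chart_inv_component [OF assms])
qed

lemma exp_chart_inv_zero:
  assumes "p \<in> densities" shows "exp_chart_inv p 0 = p"
  using expect_one [OF assms] by (simp add: vec_eq_iff exp_chart_inv_component [OF assms] one_vec_def)

text \<open>
  The classical fact that the cumulant function generates the mean: its differential at \<open>u\<close> is the
  expectation under the tilted density.
\<close>

lemma cumulant_has_derivative:
  assumes p: "p \<in> densities"
  shows "(cumulant p has_derivative expect (exp_chart_inv p u)) (at u within S)"
proof -
  let ?Z = "expect p (\<chi> x. exp (u $ x))"
  have "((\<lambda>u. \<chi> x. exp (u $ x)) has_derivative (\<lambda>k. \<chi> x. exp (u $ x) * k $ x)) (at u within S)"
    by (intro has_derivative_vecI) (auto intro!: derivative_eq_intros bounded_linear_imp_has_derivative)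
  then have "((\<lambda>u. expect p (\<chi> x. exp (u $ x))) has_derivative
      (\<lambda>k. expect p (\<chi> x. exp (u $ x) * k $ x))) (at u within S)"
    by (rule bounded_linear.has_derivative [OF expect.bounded_linear_right])
  then have "((\<lambda>u. ln (expect p (\<chi> x. exp (u $ x)))) has_derivative
      (\<lambda>k. expect p (\<chi> x. exp (u $ x) * k $ x) * inverse ?Z)) (at u within S)"
    using expect_exp_pos [OF p, of u] by (auto intro!: derivative_eq_intros)
  moreover have "expect p (\<chi> x. exp (u $ x) * k $ x) * inverse ?Z = expect (exp_chart_inv p u) k" for k
  proof -
    have "expect (exp_chart_inv p u) k = expect (inverse ?Z *\<^sub>R (\<chi> x. exp (u $ x) * p $ x)) k"
      by (rule arg_cong [of _ _ "\<lambda>q. expect q k"])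
         (simp add: vec_eq_iff exp_chart_inv_component [OF p] divide_inverse)
    then show ?thesis
      unfolding expect.scaleR_left by (simp add: expect_def mult_ac)
  qed
  ultimately show ?thesis
    by (simp add: cumulant_def [abs_def])
qed

lemma exp_chart_inv_has_derivative:
  assumes p: "p \<in> densities"
  shows "(exp_chart_inv p has_derivative
      (\<lambda>k. exp_transport p (exp_chart_inv p u) k * exp_chart_inv p u)) (at u within S)"
proof (rule has_derivative_vecI)
  fix x
  have 1: "((\<lambda>u. u $ x) has_derivative (\<lambda>k. k $ x)) (at u within S)"
    by (intro bounded_linear_imp_has_derivative bounded_linear_vec_nth)
  show "((\<lambda>u. exp_chart_inv p u $ x) has_derivative
      (\<lambda>k. (exp_transport p (exp_chart_inv p u) k * exp_chart_inv p u) $ x)) (at u within S)"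
    unfolding exp_chart_inv_def [of p] vec_lambda_beta
    by (auto intro!: derivative_eq_intros 1 cumulant_has_derivative [OF p]
          simp: exp_transport_def exp_chart_inv_def)
qed

text \<open>
  The chart centred at \<open>q\<close> itself, with \<open>u = 0\<close>, always qualifies in the defining property of a
  gradient, and it alone determines the gradient.
\<close>

lemma chart_gradient_unique:
  assumes q: "q \<in> densities" and g: "g \<in> mix_fiber q" "g' \<in> mix_fiber q"
    and D: "(F has_derivative D) (at 0 within exp_fiber q)"
      "\<forall>h\<in>exp_fiber q. pairing q g h = D (exp_transport q q h)"
    and D': "(F has_derivative D') (at 0 within exp_fiber q)"
      "\<forall>h\<in>exp_fiber q. pairing q g' h = D' (exp_transport q q h)"
  shows "g = g'"
proof (rule pairing_eq_imp_eq [OF q g])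
  fix h assume h: "h \<in> exp_fiber q"
  have "D (exp_transport q q h) = D' (exp_transport q q h)"
    using D(1) D'(1) exp_transport_in_fiber [OF q] subspace_0 [OF exp_fiber_subspace]
    by (intro has_derivative_unique_along_subspace [OF exp_fiber_subspace]) auto
  then show "pairing q g h = pairing q g' h"
    using D(2) D'(2) h by simp
qed

lemma is_grad_exp_unique:
  assumes q: "q \<in> densities" and w: "w \<in> exp_fiber q"
    and g: "is_grad_exp L q w t g" "is_grad_exp L q w t g'"
  shows "g = g'"
proof -
  have "q = exp_chart_inv q 0" "w = exp_transport q q w" "0 \<in> exp_fiber q"
    using q w by (auto simp: exp_chart_inv_zero exp_transport_eq exp_fiber_def expect.zero_right)
  then have "\<exists>D. ((\<lambda>u'. L (exp_chart_inv q u') (exp_transport q (exp_chart_inv q u') w) t)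
        has_derivative D) (at 0 within exp_fiber q) \<and>
      (\<forall>h\<in>exp_fiber q. pairing q f h = D (exp_transport q q h))"
    if "is_grad_exp L q w t f" for f
    using that q w unfolding is_grad_exp_def by blast
  from this [OF g(1)] this [OF g(2)] show ?thesis
    using g chart_gradient_unique [OF q, of g g'] unfolding is_grad_exp_def by blast
qed

lemma is_grad_mix_unique:
  assumes q: "q \<in> densities" and \<eta>: "\<eta> \<in> mix_fiber q"
    and g: "is_grad_mix H q \<eta> t g" "is_grad_mix H q \<eta> t g'"
  shows "g = g'"
proof -
  have "q = exp_chart_inv q 0" "\<eta> = mix_transport q q \<eta>" "0 \<in> exp_fiber q"
    using densities_nonzero [OF q] q
    by (auto simp: exp_chart_inv_zero exp_fiber_def expect.zero_right mix_transport_def vec_eq_iff)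
  then have "\<exists>D. ((\<lambda>u'. H (exp_chart_inv q u') (mix_transport q (exp_chart_inv q u') \<eta>) t)
        has_derivative D) (at 0 within exp_fiber q) \<and>
      (\<forall>h\<in>exp_fiber q. pairing q f h = D (exp_transport q q h))"
    if "is_grad_mix H q \<eta> t f" for f
    using that q \<eta> unfolding is_grad_mix_def by blast
  from this [OF g(1)] this [OF g(2)] show ?thesis
    using g chart_gradient_unique [OF q, of g g'] unfolding is_grad_mix_def by blast
qed

text \<open>
  The second property is the linearisation of \<open>mix_transport p q \<zeta> * q = p * \<zeta>\<close>, whose right-hand side
  does not depend on \<open>q\<close>. It removes the pairing term from the gradient of the Hamiltonian.
\<close>

lemma mix_transport_has_derivative:
  fixes f :: "'b::real_normed_vector \<Rightarrow> real ^ 'm::finite"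
  assumes f: "(f has_derivative f') (at u within S)" and nz: "\<And>x. f u $ x \<noteq> 0"
  obtains b where "((\<lambda>u. mix_transport p (f u) \<zeta>) has_derivative b) (at u within S)"
    "\<And>k. b k * f u + mix_transport p (f u) \<zeta> * f' k = 0"
proof -
  let ?b = "\<lambda>k. \<chi> x. - (p $ x * f' k $ x / (f u $ x * f u $ x) * \<zeta> $ x)"
  have "((\<lambda>u. mix_transport p (f u) \<zeta>) has_derivative ?b) (at u within S)"
  proof (rule has_derivative_vecI)
    fix x
    have "((\<lambda>u. f u $ x) has_derivative (\<lambda>k. f' k $ x)) (at u within S)"
      using f by (rule bounded_linear.has_derivative [OF bounded_linear_vec_nth])
    then show "((\<lambda>u. mix_transport p (f u) \<zeta> $ x) has_derivative (\<lambda>k. ?b k $ x)) (at u within S)"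
      using nz unfolding mix_transport_def vec_lambda_beta
      by (auto intro!: derivative_eq_intros simp: divide_inverse)
  qed
  then show thesis
    using nz by (intro that) (auto simp: vec_eq_iff mix_transport_def field_simps)
qed

text \<open>
  Transporting a fiber vector from the target back to the source of the chart undoes the
  normalisation, so along the transported direction the density moves with logarithmic velocity
  exactly \<open>h\<close>.
\<close>

lemma exp_transport_cancel:
  assumes "q \<in> densities" "h \<in> exp_fiber q"
  shows "exp_transport p q (exp_transport q p h) = h"
  using assms
  by (simp add: exp_transport_eq exp_fiber_def expect.diff_right expect.scaleR_right expect_one)

lemma linear_chart_direction:
  assumes "linear D"
  shows "linear (\<lambda>h. D ((h * q, - expect (h * q) w *\<^sub>R 1), 0))"
  by (rule linear_compose [OF _ assms, unfolded o_def])
     (auto intro!: linearI simp: vec_times.add_left vec_times.scaleR_left expect.add_left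
        expect.scaleR_left algebra_simps)

section \<open>Gradients of a smooth Lagrangian\<close>

locale lagrangian =
  fixes L :: "real ^ 'n::finite \<Rightarrow> real ^ 'n \<Rightarrow> real \<Rightarrow> real"
  assumes L_smooth: "smooth_on (exp_bundle \<times> {0..1}) (\<lambda>((q, w), t). L q w t)"
begin

abbreviation has_L_derivative where
  "has_L_derivative D q w t \<equiv>
     ((\<lambda>((q, w), t). L q w t) has_derivative D) (at ((q, w), t) within exp_bundle \<times> {0..1})"

lemma L_derivative_exists:
  assumes "q \<in> densities" "w \<in> exp_fiber q" "t \<in> {0..1}"
  obtains D where "has_L_derivative D q w t"
  using smooth_on_has_derivative [OF L_smooth, of "((q, w), t)"] assms
  by (auto simp: exp_bundle_def)

lemma is_fiber_grad_e_riesz: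
  assumes q: "q \<in> densities" and w: "w \<in> exp_fiber q" and t: "t \<in> {0..1}"
    and D: "has_L_derivative D q w t"
  shows "is_fiber_grad_e L q w t (riesz q (\<chi> x. D ((0, axis x 1), 0)))"
  unfolding is_fiber_grad_e_def
proof (intro conjI ballI)
  show "riesz q (\<chi> x. D ((0, axis x 1), 0)) \<in> mix_fiber q"
    using q by (rule riesz_in_fiber)
  fix \<beta> assume \<beta>: "\<beta> \<in> exp_fiber q"
  interpret D: bounded_linear D
    using D by (rule has_derivative_bounded_linear)
  have "((\<lambda>s. (\<lambda>((q, w), t). L q w t) ((q, w + s *\<^sub>R \<beta>), t)) has_derivative
      (\<lambda>s. D ((0, s *\<^sub>R \<beta>), 0))) (at 0)"
  proof (rule has_derivative_chain_within [where T = "exp_bundle \<times> {0..1}"])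
    show "((\<lambda>((q, w), t). L q w t) has_derivative D)
        (at ((q, w + 0 *\<^sub>R \<beta>), t) within exp_bundle \<times> {0..1})"
      using D by simp
    show "((\<lambda>s. ((q, w + s *\<^sub>R \<beta>), t)) has_derivative (\<lambda>s. ((0, s *\<^sub>R \<beta>), 0))) (at 0)"
      by (auto intro!: derivative_eq_intros)
    show "range (\<lambda>s. ((q, w + s *\<^sub>R \<beta>), t)) \<subseteq> exp_bundle \<times> {0..1}"
      using q t w \<beta> exp_fiber_subspace [of q]
      by (auto simp: exp_bundle_def intro: subspace_add subspace_scale)
  qed
  moreover have "D ((0, s *\<^sub>R \<beta>), 0) = s * D ((0, \<beta>), 0)" for s
    using D.scaleR [of s "((0, \<beta>), 0)"] by simp
  ultimately have "((\<lambda>s. L q (w + s *\<^sub>R \<beta>) t) has_real_derivative D ((0, \<beta>), 0)) (at 0)"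
    by (simp add: has_field_derivative_def mult_commute_abs)
  moreover have "pairing q (riesz q (\<chi> x. D ((0, axis x 1), 0))) \<beta> = D ((0, \<beta>), 0)"
  proof (rule pairing_riesz [OF q _ \<beta>])
    show "linear (\<lambda>\<beta>. D ((0, \<beta>), 0))"
      by (rule linear_compose [OF _ D.linear, unfolded o_def]) (auto intro!: linearI)
  qed
  ultimately show "((\<lambda>s. L q (w + s *\<^sub>R \<beta>) t) has_real_derivative
      pairing q (riesz q (\<chi> x. D ((0, axis x 1), 0))) \<beta>) (at 0)"
    by simp
qed

lemma is_fiber_grad_e_unique:
  assumes "q \<in> densities" "is_fiber_grad_e L q w t g" "is_fiber_grad_e L q w t g'"
  shows "g = g'"
  using assms by (auto simp: is_fiber_grad_e_def intro: pairing_eq_imp_eq DERIV_unique)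

lemma fiber_grad_e_eq_riesz:
  assumes "q \<in> densities" "w \<in> exp_fiber q" "t \<in> {0..1}" "has_L_derivative D q w t"
  shows "fiber_grad_e L q w t = riesz q (\<chi> x. D ((0, axis x 1), 0))"
  unfolding fiber_grad_e_def
  using is_fiber_grad_e_riesz [OF assms] is_fiber_grad_e_unique [OF assms(1)] by blast

lemma is_fiber_grad_e_fiber_grad_e:
  assumes "q \<in> densities" "w \<in> exp_fiber q" "t \<in> {0..1}"
  shows "is_fiber_grad_e L q w t (fiber_grad_e L q w t)"
  by (metis L_derivative_exists assms fiber_grad_e_eq_riesz is_fiber_grad_e_riesz)

lemma fiber_grad_e_in_fiber:
  assumes "q \<in> densities" "w \<in> exp_fiber q" "t \<in> {0..1}"
  shows "fiber_grad_e L q w t \<in> mix_fiber q"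
  using is_fiber_grad_e_fiber_grad_e [OF assms] by (simp add: is_fiber_grad_e_def)

text \<open>
  Near any point, the fiber gradient is the Riesz representative of the fiber derivatives of a smooth
  extension of \<open>L\<close>, an explicit formula in quantities that are differentiable again.
\<close>

lemma fiber_grad_e_differentiable:
  assumes X: "X \<in> exp_bundle \<times> {0..1}"
  shows "(\<lambda>((q, w), t). fiber_grad_e L q w t) differentiable (at X within exp_bundle \<times> {0..1})"
proof -
  obtain U g where U: "open U" "X \<in> U" and "\<forall>k. Ck_on k g U"
    and g_eq: "\<forall>Y\<in>exp_bundle \<times> {0..1} \<inter> U. (\<lambda>((q, w), t). L q w t) Y = g Y"
    using L_smooth X unfolding smooth_on_def by meson
  then have "Ck_on 2 g U"
    by blast
  then have g1: "\<And>Y. Y \<in> U \<Longrightarrow> g differentiable at Y"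
    and g2: "\<And>Y v. Y \<in> U \<Longrightarrow> (\<lambda>X. frechet_derivative g (at X) v) differentiable at Y"
    by (auto simp: numeral_2_eq_2)
  define c where "c Y = (\<chi> x. frechet_derivative g (at Y) ((0, axis x 1), 0))" for Y
  have eq: "fiber_grad_e L q w t = riesz q (c ((q, w), t))"
    if Y: "((q, w), t) \<in> U" "q \<in> densities" "w \<in> exp_fiber q" "t \<in> {0..1}" for q w t
    unfolding c_def
  proof (rule fiber_grad_e_eq_riesz [OF that(2-4)])
    have "(g has_derivative frechet_derivative g (at ((q, w), t)))
        (at ((q, w), t) within exp_bundle \<times> {0..1})"
      using g1 [OF Y(1)] by (simp add: frechet_derivative_works has_derivative_at_withinI)
    then show "has_L_derivative (frechet_derivative g (at ((q, w), t))) q w t"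
      by (rule has_derivative_transform_Int [OF _ U(1) Y(1) _ g_eq])
         (use Y in \<open>simp add: exp_bundle_def\<close>)
  qed
  have "(\<lambda>Y. riesz (fst (fst Y)) (c Y)) differentiable (at X within exp_bundle \<times> {0..1})"
  proof (rule differentiable_vecI)
    fix x
    have c: "(\<lambda>Y. c Y $ y) differentiable (at X within exp_bundle \<times> {0..1})" for y
      unfolding c_def vec_lambda_beta by (rule differentiable_at_withinI [OF g2 [OF U(2)]])
    have q: "(\<lambda>Y. fst (fst Y) $ x) differentiable (at X within exp_bundle \<times> {0..1})"
      by (intro bounded_linear_imp_differentiable bounded_linear_compose [OF bounded_linear_vec_nth]
          bounded_linear_compose [OF bounded_linear_fst] bounded_linear_fst)
    have "fst (fst X) $ x \<noteq> 0"
      using X by (auto simp: exp_bundle_def densities_nonzero)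
    then show "(\<lambda>Y. riesz (fst (fst Y)) (c Y) $ x) differentiable
        (at X within exp_bundle \<times> {0..1})"
      unfolding riesz_def vec_lambda_beta
      by (intro differentiable_diff differentiable_divide differentiable_mult differentiable_const
            differentiable_sum c q) (auto intro: c)
  qed
  then obtain D where D: "((\<lambda>Y. riesz (fst (fst Y)) (c Y)) has_derivative D)
      (at X within exp_bundle \<times> {0..1})"
    by (auto simp: differentiable_def)
  then have "((\<lambda>((q, w), t). fiber_grad_e L q w t) has_derivative D)
      (at X within exp_bundle \<times> {0..1})"
    by (rule has_derivative_transform_Int [OF _ U X]) (auto simp: exp_bundle_def eq)
  then show ?thesis
    by (auto simp: differentiable_def)
qed

lemma fiber_grad_e_continuous_on:
  "continuous_on (exp_bundle \<times> {0..1}) (\<lambda>((q, w), t). fiber_grad_e L q w t)"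
  by (rule differentiable_imp_continuous_on)
     (simp add: differentiable_on_def fiber_grad_e_differentiable)

text \<open>
  By the chain rule, a chart direction \<open>h\<close> moves the density by \<open>h * q\<close> and the transported velocity
  by a constant, the correction of its mean. This depends neither on the centre \<open>p\<close> of the chart nor on
  the representative \<open>v\<close> of \<open>w\<close>, so that one vector serves all charts.
\<close>

lemma is_grad_exp_riesz:
  assumes q: "q \<in> densities" and w: "w \<in> exp_fiber q" and t: "t \<in> {0..1}"
    and D: "has_L_derivative D q w t"
  defines "l \<equiv> \<lambda>h. D ((h * q, - expect (h * q) w *\<^sub>R 1), 0)"
  shows "is_grad_exp L q w t (riesz q (\<chi> x. l (axis x 1)))"
  unfolding is_grad_exp_def
proof (intro conjI ballI impI)
  show "riesz q (\<chi> x. l (axis x 1)) \<in> mix_fiber q"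
    using q by (rule riesz_in_fiber)
next
  fix p u v
  assume p: "p \<in> densities" and u: "u \<in> exp_fiber p" and v: "v \<in> exp_fiber p"
    and qu: "q = exp_chart_inv p u" and wv: "w = exp_transport p q v"
  interpret D: bounded_linear D
    using D by (rule has_derivative_bounded_linear)
  have l: "linear l"
    unfolding l_def by (rule linear_chart_direction [OF D.linear])
  let ?a = "\<lambda>k. exp_transport p q k * q"
  let ?D = "\<lambda>k. D ((?a k, - expect (?a k) v *\<^sub>R 1), 0)"
  have e: "(exp_chart_inv p has_derivative ?a) (at u within exp_fiber p)"
    using exp_chart_inv_has_derivative [OF p, of u] by (simp add: qu)
  have "((\<lambda>u'. (\<lambda>((q, w), t). L q w t)
        ((exp_chart_inv p u', exp_transport p (exp_chart_inv p u') v), t))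
      has_derivative ?D) (at u within exp_fiber p)"
  proof (rule has_derivative_chain_within [where T = "exp_bundle \<times> {0..1}"])
    show "((\<lambda>((q, w), t). L q w t) has_derivative D)
        (at ((exp_chart_inv p u, exp_transport p (exp_chart_inv p u) v), t)
          within exp_bundle \<times> {0..1})"
      using D by (simp add: qu [symmetric] wv [symmetric])
    show "((\<lambda>u'. ((exp_chart_inv p u', exp_transport p (exp_chart_inv p u') v), t))
        has_derivative (\<lambda>k. ((?a k, - expect (?a k) v *\<^sub>R 1), 0))) (at u within exp_fiber p)"
      unfolding exp_transport_eq [of _ _ v]
      by (rule derivative_eq_intros e bounded_linear.has_derivative [OF expect.bounded_linear_left] refl)+
         (auto simp: fun_eq_iff)
    show "(\<lambda>u'. ((exp_chart_inv p u', exp_transport p (exp_chart_inv p u') v), t)) ` exp_fiber p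
        \<subseteq> exp_bundle \<times> {0..1}"
      using t p by (auto simp: exp_bundle_def exp_chart_inv_in_densities exp_transport_in_fiber)
  qed
  moreover have "pairing q (riesz q (\<chi> x. l (axis x 1))) h = ?D (exp_transport q p h)"
    if h: "h \<in> exp_fiber q" for h
  proof -
    have "expect (h * q) w = expect (h * q) v - expect q v * expect (h * q) 1"
      by (simp add: wv exp_transport_eq expect.diff_right expect.scaleR_right)
    also have "expect (h * q) 1 = 0"
      using h by (simp add: exp_fiber_def expect_times_move expect_commute [of h])
    finally have "expect (h * q) w = expect (h * q) v"
      by simp
    then show ?thesis
      using pairing_riesz [OF q l h] exp_transport_cancel [OF q h, of p] by (simp add: l_def)
  qed
  ultimately show "\<exists>D. ((\<lambda>u'. L (exp_chart_inv p u') (exp_transport p (exp_chart_inv p u') v) t)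
      has_derivative D) (at u within exp_fiber p) \<and>
      (\<forall>h\<in>exp_fiber q. pairing q (riesz q (\<chi> x. l (axis x 1))) h = D (exp_transport q p h))"
    by (intro exI [of _ ?D]) simp
qed

lemma grad_exp_eq_riesz:
  assumes q: "q \<in> densities" and w: "w \<in> exp_fiber q" and t: "t \<in> {0..1}"
    and D: "has_L_derivative D q w t"
  shows "grad_exp L q w t = riesz q (\<chi> x. D ((axis x 1 * q, - expect (axis x 1 * q) w *\<^sub>R 1), 0))"
  unfolding grad_exp_def
  using is_grad_exp_riesz [OF q w t D] is_grad_exp_unique [OF q w] by blast

lemma grad_exp_in_fiber:
  assumes "q \<in> densities" "w \<in> exp_fiber q" "t \<in> {0..1}"
  shows "grad_exp L q w t \<in> mix_fiber q"
proof -
  obtain D where "has_L_derivative D q w t"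
    using L_derivative_exists [OF assms] .
  from grad_exp_eq_riesz [OF assms this] show ?thesis
    using riesz_in_fiber [OF assms(1)] by simp
qed

lemma pairing_grad_exp:
  assumes q: "q \<in> densities" and w: "w \<in> exp_fiber q" and t: "t \<in> {0..1}"
    and D: "has_L_derivative D q w t" and h: "h \<in> exp_fiber q"
  shows "pairing q (grad_exp L q w t) h = D ((h * q, - expect (h * q) w *\<^sub>R 1), 0)"
  unfolding grad_exp_eq_riesz [OF q w t D]
  by (rule pairing_riesz [OF q linear_chart_direction h])
     (use D in \<open>simp add: has_derivative_linear\<close>)

end

section \<open>Regularity of the inverse Legendre map\<close>

locale hyperregular_lagrangian = lagrangian L
  for L :: "real ^ 'n::finite \<Rightarrow> real ^ 'n \<Rightarrow> real \<Rightarrow> real" +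
  assumes fiber_bij: "\<And>q t. q \<in> densities \<Longrightarrow> t \<in> {0..1} \<Longrightarrow>
        bij_betw (\<lambda>w. fiber_grad_e L q w t) (exp_fiber q) (mix_fiber q)"
    and legendre_diffeo: "\<And>t. t \<in> {0..1} \<Longrightarrow>
        diffeomorphism_on exp_bundle mix_bundle (\<lambda>(q, w). (q, fiber_grad_e L q w t))"
begin

definition legendre_inv :: "real ^ 'n \<Rightarrow> real ^ 'n \<Rightarrow> real \<Rightarrow> real ^ 'n" where
  "legendre_inv q \<eta> t = inv_into (exp_fiber q) (\<lambda>w. fiber_grad_e L q w t) \<eta>"

lemma hamiltonian_eq:
  "hamiltonian L q \<eta> t = pairing q \<eta> (legendre_inv q \<eta> t) - L q (legendre_inv q \<eta> t) t"
  by (simp add: hamiltonian_def legendre_inv_def Let_def)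

lemma legendre_inv_in_fiber:
  assumes "q \<in> densities" "\<eta> \<in> mix_fiber q" "t \<in> {0..1}"
  shows "legendre_inv q \<eta> t \<in> exp_fiber q"
  using fiber_bij [OF assms(1,3)] assms(2)
  by (auto simp: legendre_inv_def bij_betw_def intro!: inv_into_into)

lemma fiber_grad_e_legendre_inv:
  assumes "q \<in> densities" "\<eta> \<in> mix_fiber q" "t \<in> {0..1}"
  shows "fiber_grad_e L q (legendre_inv q \<eta> t) t = \<eta>"
  using bij_betw_inv_into_right [OF fiber_bij [OF assms(1,3)] assms(2)]
  by (simp add: legendre_inv_def)

lemma legendre_inv_fiber_grad_e:
  assumes "q \<in> densities" "w \<in> exp_fiber q" "t \<in> {0..1}"
  shows "legendre_inv q (fiber_grad_e L q w t) t = w"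
  using bij_betw_inv_into_left [OF fiber_bij [OF assms(1,3)] assms(2)]
  by (simp add: legendre_inv_def)

lemma legendre_inv_smooth:
  assumes t: "t \<in> {0..1}"
  shows "smooth_on mix_bundle (\<lambda>(q, \<eta>). (q, legendre_inv q \<eta> t))"
proof -
  let ?f = "\<lambda>(q, w). (q, fiber_grad_e L q w t)"
  have inj: "inj_on ?f exp_bundle" and smooth: "smooth_on mix_bundle (inv_into exp_bundle ?f)"
    using legendre_diffeo [OF t] by (auto simp: diffeomorphism_on_def bij_betw_def)
  have "inv_into exp_bundle ?f (q, \<eta>) = (q, legendre_inv q \<eta> t)" if "(q, \<eta>) \<in> mix_bundle" for q \<eta>
    by (rule inv_into_f_eq [OF inj])
       (use that t in \<open>auto simp: mix_bundle_def exp_bundle_def legendre_inv_in_fiber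
          fiber_grad_e_legendre_inv\<close>)
  then show ?thesis
    using smooth unfolding smooth_on_def
    by (smt (verit, del_insts) IntD1 case_prod_conv surj_pair)
qed

lemma legendre_inv_continuous_on_fiber:
  assumes "q \<in> densities" "t \<in> {0..1}"
  shows "continuous_on (mix_fiber q) (\<lambda>\<eta>. legendre_inv q \<eta> t)"
proof -
  have "continuous_on (mix_fiber q) (\<lambda>\<eta>. snd ((\<lambda>(q, \<eta>). (q, legendre_inv q \<eta> t)) (q, \<eta>)))"
    by (intro continuous_on_snd continuous_on_compose2
          [OF smooth_on_imp_continuous_on [OF legendre_inv_smooth [OF assms(2)]]] continuous_intros)
       (use assms in \<open>auto simp: mix_bundle_def\<close>)
  then show ?thesis
    by simp
qed

lemma fiber_grad_e_continuous_on_fiber: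
  assumes "q \<in> densities" "t \<in> {0..1}"
  shows "continuous_on (exp_fiber q) (\<lambda>w. fiber_grad_e L q w t)"
proof -
  have "continuous_on (exp_fiber q) (\<lambda>w. (\<lambda>((q, w), t). fiber_grad_e L q w t) ((q, w), t))"
    by (intro continuous_on_compose2 [OF fiber_grad_e_continuous_on] continuous_intros)
       (use assms in \<open>auto simp: exp_bundle_def\<close>)
  then show ?thesis
    by simp
qed

lemma legendre_inv_lipschitz_at_fixed_time:
  assumes q0: "q0 \<in> densities" and \<eta>0: "\<eta>0 \<in> mix_fiber q0" and t: "t \<in> {0..1}"
  obtains B d where "0 \<le> B" "0 < d"
    "\<And>q \<eta>. q \<in> densities \<Longrightarrow> \<eta> \<in> mix_fiber q \<Longrightarrow> norm (q - q0) + norm (\<eta> - \<eta>0) < d \<Longrightarrow>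
       norm (legendre_inv q \<eta> t - legendre_inv q0 \<eta>0 t) \<le> B * (norm (q - q0) + norm (\<eta> - \<eta>0))"
proof -
  obtain D where "((\<lambda>(q, \<eta>). (q, legendre_inv q \<eta> t)) has_derivative D) (at (q0, \<eta>0) within mix_bundle)"
    using smooth_on_has_derivative [OF legendre_inv_smooth [OF t]] q0 \<eta>0
    by (metis (mono_tags, lifting) case_prodI mem_Collect_eq mix_bundle_def)
  then obtain B d where B: "0 \<le> B" and d: "0 < d"
    and le: "\<And>y. y \<in> mix_bundle \<Longrightarrow> norm (y - (q0, \<eta>0)) < d \<Longrightarrow>
      norm ((\<lambda>(q, \<eta>). (q, legendre_inv q \<eta> t)) y - (\<lambda>(q, \<eta>). (q, legendre_inv q \<eta> t)) (q0, \<eta>0))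
        \<le> B * norm (y - (q0, \<eta>0))"
    by (rule has_derivative_imp_lipschitz_at) blast
  show thesis
  proof (rule that [OF B d])
    fix q \<eta> assume q: "q \<in> densities" and \<eta>: "\<eta> \<in> mix_fiber q"
      and less: "norm (q - q0) + norm (\<eta> - \<eta>0) < d"
    have le': "norm ((q, \<eta>) - (q0, \<eta>0)) \<le> norm (q - q0) + norm (\<eta> - \<eta>0)"
      by (simp add: norm_Pair_le)
    have "norm (legendre_inv q \<eta> t - legendre_inv q0 \<eta>0 t)
        \<le> norm ((q, legendre_inv q \<eta> t) - (q0, legendre_inv q0 \<eta>0 t))"
      by (simp add: norm_snd_le)
    also have "\<dots> \<le> B * norm ((q, \<eta>) - (q0, \<eta>0))"
      using le [of "(q, \<eta>)"] q \<eta> le' less by (simp add: mix_bundle_def)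
    also have "\<dots> \<le> B * (norm (q - q0) + norm (\<eta> - \<eta>0))"
      using le' B by (rule mult_left_mono)
    finally show "norm (legendre_inv q \<eta> t - legendre_inv q0 \<eta>0 t)
        \<le> B * (norm (q - q0) + norm (\<eta> - \<eta>0))" .
  qed
qed

text \<open>
  Let \<open>F\<close> be the fiber gradient. A vector \<open>w\<close> of the fiber solves \<open>F q w t = \<eta>\<close> iff it is a fixed
  point of \<open>w \<mapsto> legendre_inv q (F q w t0 - F q w t + \<eta>) t0\<close>. Near the base point, \<open>F\<close> is affine up to
  a small multiple \<open>\<epsilon>\<close> of the displacement, and the affine parts of \<open>F q w t0\<close> and \<open>F q w t\<close> differ
  by a multiple of \<open>t - t0\<close>. So this map sends a ball of radius \<open>R * d\<close> around \<open>w0\<close> into itself when \<open>d\<close>,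
  the displacement of \<open>(q, \<eta>, t)\<close>, is small and \<open>R\<close> is large enough; Brouwer's theorem gives the
  solution in this ball.
\<close>

lemma legendre_inv_lipschitz_at:
  assumes q0: "q0 \<in> densities" and \<eta>0: "\<eta>0 \<in> mix_fiber q0" and t0: "t0 \<in> {0..1}"
  obtains R d where "0 \<le> R" "0 < d"
    "\<And>q \<eta> t. q \<in> densities \<Longrightarrow> \<eta> \<in> mix_fiber q \<Longrightarrow> t \<in> {0..1} \<Longrightarrow>
       norm (((q, \<eta>), t) - ((q0, \<eta>0), t0)) < d \<Longrightarrow>
       norm (legendre_inv q \<eta> t - legendre_inv q0 \<eta>0 t0) \<le> R * norm (((q, \<eta>), t) - ((q0, \<eta>0), t0))"
proof -
  define w0 where "w0 = legendre_inv q0 \<eta>0 t0"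
  have w0: "w0 \<in> exp_fiber q0"
    unfolding w0_def using assms by (rule legendre_inv_in_fiber)
  have F0: "fiber_grad_e L q0 w0 t0 = \<eta>0"
    unfolding w0_def using assms by (rule fiber_grad_e_legendre_inv)
  obtain G dG where G: "0 \<le> G" and dG: "0 < dG"
    and G_le: "\<And>q \<eta>. q \<in> densities \<Longrightarrow> \<eta> \<in> mix_fiber q \<Longrightarrow> norm (q - q0) + norm (\<eta> - \<eta>0) < dG \<Longrightarrow>
       norm (legendre_inv q \<eta> t0 - w0) \<le> G * (norm (q - q0) + norm (\<eta> - \<eta>0))"
    using legendre_inv_lipschitz_at_fixed_time [OF assms] unfolding w0_def by metis
  have "((q0, w0), t0) \<in> exp_bundle \<times> {0..1}"
    using q0 w0 t0 by (simp add: exp_bundle_def)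
  then obtain D where D: "((\<lambda>((q, w), t). fiber_grad_e L q w t) has_derivative D)
      (at ((q0, w0), t0) within exp_bundle \<times> {0..1})"
    using fiber_grad_e_differentiable unfolding differentiable_def by blast
  interpret D: bounded_linear D
    using D by (rule has_derivative_bounded_linear)
  obtain BD where BD: "0 \<le> BD" "\<And>X. norm (D X) \<le> norm X * BD"
    using D.nonneg_bounded by metis
  \<comment> \<open>Small enough that the contribution of \<open>R\<close> to the radius, after applying the inverse at time
      \<open>t0\<close> with its constant \<open>G\<close>, is at most \<open>R / 2\<close>.\<close>
  define \<epsilon> where "\<epsilon> = 1 / (4 * (G + 1))"
  have \<epsilon>: "0 < \<epsilon>" "G * (2 * \<epsilon>) \<le> 1 / 2" "2 * \<epsilon> \<le> 1 / 2"
    using G by (auto simp: \<epsilon>_def field_simps)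
  obtain dF where dF: "0 < dF"
    and F_le: "\<And>X. X \<in> exp_bundle \<times> {0..1} \<Longrightarrow> norm (X - ((q0, w0), t0)) < dF \<Longrightarrow>
      norm ((\<lambda>((q, w), t). fiber_grad_e L q w t) X -
        (\<lambda>((q, w), t). fiber_grad_e L q w t) ((q0, w0), t0) - D (X - ((q0, w0), t0)))
      \<le> \<epsilon> * norm (X - ((q0, w0), t0))"
    using D \<epsilon>(1) unfolding has_derivative_within_alt by meson
  obtain BW where BW: "0 \<le> BW" "\<And>q. norm (exp_transport q0 q w0 - w0) \<le> BW * norm (q - q0)"
    using exp_transport_lipschitz_at [OF w0] by metis
  \<comment> \<open>The summand \<open>BW\<close> puts the transported vector \<open>w0\<close> into the ball, which is thus nonempty; the
      remaining part makes the ball invariant.\<close>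
  define R where "R = BW + 2 * (G * (2 + BD)) + 2"
  have R: "0 \<le> R" "BW \<le> R" "G * (2 + BD) + 1 + R / 2 \<le> R"
    using BW(1) G BD(1) by (auto simp: R_def)
  define A where "A = 3 + BD + R / 2"
  have A: "0 < A"
    using R BD by (simp add: A_def)
  define \<delta> where "\<delta> = min (dG / A) (dF / (2 + R))"
  have "0 < \<delta>"
    using A R dG dF by (simp add: \<delta>_def)
  moreover have "norm (legendre_inv q \<eta> t - w0) \<le> R * norm (((q, \<eta>), t) - ((q0, \<eta>0), t0))"
    if q: "q \<in> densities" and \<eta>: "\<eta> \<in> mix_fiber q" and t: "t \<in> {0..1}"
      and less: "norm (((q, \<eta>), t) - ((q0, \<eta>0), t0)) < \<delta>" for q \<eta> t
  proof -
    define d where "d = norm (((q, \<eta>), t) - ((q0, \<eta>0), t0))"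
    have d: "0 \<le> d" "A * d < dG" "(2 + R) * d < dF"
      using less A R by (auto simp: \<delta>_def d_def field_simps)
    have "norm ((q, \<eta>) - (q0, \<eta>0)) \<le> d" "norm (t - t0) \<le> d"
      unfolding d_def by (metis diff_Pair norm_fst_le, metis diff_Pair norm_snd_le)
    then have qd: "norm (q - q0) \<le> d" and \<eta>d: "norm (\<eta> - \<eta>0) \<le> d" and td: "norm (t - t0) \<le> d"
      by (metis diff_Pair norm_fst_le order_trans, metis diff_Pair norm_snd_le order_trans, simp)
    define S where "S = cball w0 (R * d) \<inter> exp_fiber q"
    define \<eta>' where "\<eta>' w = fiber_grad_e L q w t0 - fiber_grad_e L q w t + \<eta>" for w
    have \<eta>'_in: "\<eta>' w \<in> mix_fiber q" if "w \<in> exp_fiber q" for w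
      unfolding \<eta>'_def mix_fiber_eq_exp_fiber
      by (intro subspace_add subspace_diff exp_fiber_subspace)
         (use fiber_grad_e_in_fiber that q t t0 \<eta> in \<open>auto simp: mix_fiber_eq_exp_fiber\<close>)
    have \<eta>'_near: "norm (q - q0) + norm (\<eta>' w - \<eta>0) \<le> (2 + BD + 2 * \<epsilon> * (2 + R)) * d"
      if w: "w \<in> S" for w
    proof -
      have wf: "w \<in> exp_fiber q" and wd: "norm (w - w0) \<le> R * d"
        using w by (auto simp: S_def dist_norm norm_minus_commute)
      have near: "norm (fiber_grad_e L q w s - \<eta>0 - D (((q, w), s) - ((q0, w0), t0)))
          \<le> \<epsilon> * ((2 + R) * d)" if s: "s \<in> {0..1}" "norm (s - t0) \<le> d" for s
      proof -
        have "norm (((q, w), s) - ((q0, w0), t0)) \<le> norm (q - q0, w - w0) + norm (s - t0)"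
          using norm_Pair_le [of "(q - q0, w - w0)" "s - t0"] by simp
        also have "\<dots> \<le> norm (q - q0) + norm (w - w0) + norm (s - t0)"
          by (simp add: norm_Pair_le)
        also have "\<dots> \<le> (2 + R) * d"
          using qd wd s(2) by (simp add: algebra_simps)
        finally have le: "norm (((q, w), s) - ((q0, w0), t0)) \<le> (2 + R) * d" .
        then have "norm (fiber_grad_e L q w s - \<eta>0 - D (((q, w), s) - ((q0, w0), t0)))
            \<le> \<epsilon> * norm (((q, w), s) - ((q0, w0), t0))"
          using F_le [of "((q, w), s)"] d(3) q wf s(1) by (simp add: exp_bundle_def F0)
        also have "\<dots> \<le> \<epsilon> * ((2 + R) * d)"
          using le \<epsilon>(1) by simp
        finally show ?thesis .
      qed
      let ?E = "\<lambda>s. fiber_grad_e L q w s - \<eta>0 - D (((q, w), s) - ((q0, w0), t0))"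
      have "D (((q, w), t0) - ((q0, w0), t0)) - D (((q, w), t) - ((q0, w0), t0)) = D ((0, 0), t0 - t)"
        by (simp flip: D.diff add: zero_prod_def)
      then have "\<eta>' w - \<eta>0 = ?E t0 - ?E t + D ((0, 0), t0 - t) + (\<eta> - \<eta>0)"
        by (simp add: \<eta>'_def algebra_simps)
      also have "norm \<dots> \<le> norm (?E t0) + norm (?E t) + norm (D ((0, 0), t0 - t)) + norm (\<eta> - \<eta>0)"
        by (intro norm_triangle_le add_mono norm_triangle_ineq4 order_refl)
      also have "\<dots> \<le> \<epsilon> * ((2 + R) * d) + \<epsilon> * ((2 + R) * d) + d * BD + d"
      proof (intro add_mono near t t0 td \<eta>d)
        have "norm (D ((0, 0), t0 - t)) \<le> norm (t0 - t) * BD"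
          using BD(2) [of "((0, 0), t0 - t)"] by (simp flip: zero_prod_def)
        also have "\<dots> \<le> d * BD"
          using td BD(1) by (intro mult_right_mono) (auto simp: abs_minus_commute)
        finally show "norm (D ((0, 0), t0 - t)) \<le> d * BD" .
      qed (use d in auto)
      finally show ?thesis
        using qd by (simp add: algebra_simps)
    qed
    define T where "T w = legendre_inv q (\<eta>' w) t0" for w
    have T_in: "T w \<in> S" if w: "w \<in> S" for w
    proof -
      have wf: "w \<in> exp_fiber q"
        using w by (simp add: S_def)
      have "(2 * \<epsilon>) * ((2 + R) * d) \<le> (1 / 2) * ((2 + R) * d)"
        using \<epsilon>(3) R d by (intro mult_right_mono) auto
      then have "norm (q - q0) + norm (\<eta>' w - \<eta>0) \<le> A * d"
        using \<eta>'_near [OF w] by (simp add: A_def algebra_simps)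
      then have "norm (T w - w0) \<le> G * (norm (q - q0) + norm (\<eta>' w - \<eta>0))"
        unfolding T_def using d(2) by (intro G_le q \<eta>'_in wf) simp
      also have "\<dots> \<le> G * ((2 + BD + 2 * \<epsilon> * (2 + R)) * d)"
        using \<eta>'_near [OF w] G by (rule mult_left_mono)
      also have "\<dots> = (G * (2 + BD) + G * (2 * \<epsilon>) * (2 + R)) * d"
        by (simp add: algebra_simps)
      also have "\<dots> \<le> (G * (2 + BD) + 1 / 2 * (2 + R)) * d"
        using \<epsilon>(2) R(1) d(1) by (intro mult_right_mono add_left_mono) auto
      also have "\<dots> \<le> R * d"
        using R(3) d(1) by (intro mult_right_mono) (simp_all add: add_divide_distrib)
      finally show ?thesis
        using legendre_inv_in_fiber [OF q \<eta>'_in [OF wf] t0]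
        by (simp add: S_def T_def dist_norm norm_minus_commute)
    qed
    have "exp_transport q0 q w0 \<in> S"
    proof -
      have "norm (exp_transport q0 q w0 - w0) \<le> R * d"
        using BW(2) [of q] mult_mono [OF R(2) qd R(1)] by simp
      then show ?thesis
        using exp_transport_in_fiber [OF q] by (simp add: S_def dist_norm norm_minus_commute)
    qed
    moreover have "compact S" "convex S"
      by (simp_all add: S_def compact_Int_closed closed_subspace convex_Int subspace_imp_convex
          exp_fiber_subspace)
    moreover have "continuous_on S T"
    proof -
      have "continuous_on (exp_fiber q) \<eta>'"
        unfolding \<eta>'_def by (intro continuous_intros fiber_grad_e_continuous_on_fiber q t t0)
      then have "continuous_on (exp_fiber q) T"
        unfolding T_def
        by (rule continuous_on_compose2 [OF legendre_inv_continuous_on_fiber [OF q t0]])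
           (auto intro: \<eta>'_in)
      then show ?thesis
        by (rule continuous_on_subset) (simp add: S_def)
    qed
    ultimately obtain w where w: "w \<in> S" "T w = w"
      using brouwer [of S T] T_in by blast
    then have wf: "w \<in> exp_fiber q"
      by (simp add: S_def)
    have "fiber_grad_e L q w t0 = \<eta>' w"
      using fiber_grad_e_legendre_inv [OF q \<eta>'_in [OF wf] t0] w(2) by (simp add: T_def)
    then have "fiber_grad_e L q w t = \<eta>"
      by (simp add: \<eta>'_def)
    then have "legendre_inv q \<eta> t = w"
      using legendre_inv_fiber_grad_e [OF q wf t] by simp
    then show ?thesis
      using w(1) by (simp add: S_def dist_norm norm_minus_commute d_def)
  qed
  ultimately show thesis
    using that R(1) unfolding w0_def by blast
qed

section \<open>The differential of the Hamiltonian\<close>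

text \<open>
  The function \<open>v \<mapsto> \<langle>\<eta>, v\<rangle> - L q v t\<close> changes along a segment of the fiber by \<open>\<beta>\<close> paired with the
  defect of the equation \<open>Grad\<^sub>e L q v t = \<eta>\<close> at an intermediate point.
\<close>

lemma legendre_defect_mean_value:
  assumes q: "q \<in> densities" and W: "W \<in> exp_fiber q" and \<beta>: "\<beta> \<in> exp_fiber q" and t: "t \<in> {0..1}"
  obtains s where "0 < s" "s < 1"
    "(pairing q \<eta> (W + \<beta>) - L q (W + \<beta>) t) - (pairing q \<eta> W - L q W t) =
       pairing q (\<eta> - fiber_grad_e L q (W + s *\<^sub>R \<beta>) t) \<beta>"
proof -
  let ?\<phi> = "\<lambda>s. pairing q \<eta> (W + s *\<^sub>R \<beta>) - L q (W + s *\<^sub>R \<beta>) t"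
  have "(?\<phi> has_real_derivative pairing q (\<eta> - fiber_grad_e L q (W + s *\<^sub>R \<beta>) t) \<beta>) (at s)" for s
  proof -
    have "W + s *\<^sub>R \<beta> \<in> exp_fiber q"
      using W \<beta> by (intro subspace_add subspace_scale exp_fiber_subspace)
    from is_fiber_grad_e_fiber_grad_e [OF q this t]
    have "((\<lambda>r. L q ((W + s *\<^sub>R \<beta>) + r *\<^sub>R \<beta>) t) has_real_derivative
        pairing q (fiber_grad_e L q (W + s *\<^sub>R \<beta>) t) \<beta>) (at 0)"
      using \<beta> by (simp add: is_fiber_grad_e_def)
    then have "((\<lambda>r. L q (W + r *\<^sub>R \<beta>) t) has_real_derivative
        pairing q (fiber_grad_e L q (W + s *\<^sub>R \<beta>) t) \<beta>) (at s)"
      using DERIV_shift [of "\<lambda>r. L q (W + r *\<^sub>R \<beta>) t" _ 0 s] by (simp add: algebra_simps)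
    then show ?thesis
      unfolding pairing_eq_expect vec_times.diff_left expect.diff_left expect.add_right expect.scaleR_right
      by (auto intro!: derivative_eq_intros)
  qed
  then obtain s where "0 < s" "s < 1"
    "?\<phi> 1 - ?\<phi> 0 = (1 - 0) * pairing q (\<eta> - fiber_grad_e L q (W + s *\<^sub>R \<beta>) t) \<beta>"
    using MVT2 [of 0 1 ?\<phi> "\<lambda>s. pairing q (\<eta> - fiber_grad_e L q (W + s *\<^sub>R \<beta>) t) \<beta>"] by auto
  then show thesis
    by (intro that) auto
qed

text \<open>
  The envelope principle. Let \<open>W q\<close> be \<open>w0\<close> transported to the fiber at \<open>q\<close>, and let \<open>K\<close> be the
  Hamiltonian with \<open>W q\<close> in place of the velocity of momentum \<open>\<eta>\<close>; its differential is explicit. The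
  difference of the two is a product of the defect of the momentum equation, which tends to zero by
  continuity, and of the distance between the two velocities, which is bounded by a multiple of the
  displacement. It is therefore negligible.
\<close>

lemma hamiltonian_has_derivative:
  assumes q0: "q0 \<in> densities" and \<eta>0: "\<eta>0 \<in> mix_fiber q0" and t0: "t0 \<in> {0..1}"
    and w0_def: "w0 = legendre_inv q0 \<eta>0 t0"
    and D: "has_L_derivative D q0 w0 t0"
  shows "((\<lambda>((q, \<eta>), t). hamiltonian L q \<eta> t) has_derivative
      (\<lambda>((a, b), \<tau>). expect (b * q0 + \<eta>0 * a) w0 - D ((a, - expect a w0 *\<^sub>R 1), \<tau>)))
      (at ((q0, \<eta>0), t0) within mix_bundle \<times> {0..1})"
proof -
  let ?N = "mix_bundle \<times> {0..1} :: (((real ^ 'n) \<times> (real ^ 'n)) \<times> real) set"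
  let ?Y0 = "((q0, \<eta>0), t0)"
  define W where "W q = exp_transport q0 q w0" for q
  define K where "K Y = expect (snd (fst Y) * fst (fst Y)) w0 - L (fst (fst Y)) (W (fst (fst Y))) (snd Y)" for Y
  have w0: "w0 \<in> exp_fiber q0"
    unfolding w0_def using q0 \<eta>0 t0 by (rule legendre_inv_in_fiber)
  have F0: "fiber_grad_e L q0 w0 t0 = \<eta>0"
    unfolding w0_def using q0 \<eta>0 t0 by (rule fiber_grad_e_legendre_inv)
  have W0: "W q0 = w0"
    using w0 by (simp add: W_def exp_transport_eq exp_fiber_def)
  have W_in: "W q \<in> exp_fiber q" if "q \<in> densities" for q
    unfolding W_def using that by (rule exp_transport_in_fiber)
  have K_deriv: "(K has_derivative (\<lambda>Y. expect (snd (fst Y) * q0 + \<eta>0 * fst (fst Y)) w0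
      - D ((fst (fst Y), - expect (fst (fst Y)) w0 *\<^sub>R 1), snd Y))) (at ?Y0 within ?N)"
  proof -
    have fst_fst: "((\<lambda>Y. fst (fst Y)) has_derivative (\<lambda>Y. fst (fst Y))) (at ?Y0 within ?N)"
      and snd_fst: "((\<lambda>Y. snd (fst Y)) has_derivative (\<lambda>Y. snd (fst Y))) (at ?Y0 within ?N)"
      and snd': "(snd has_derivative snd) (at ?Y0 within ?N)"
      by (auto intro!: derivative_eq_intros)
    have "((\<lambda>Y. (\<lambda>((q, w), t). L q w t) ((fst (fst Y), W (fst (fst Y))), snd Y)) has_derivative
        (\<lambda>Y. D ((fst (fst Y), - expect (fst (fst Y)) w0 *\<^sub>R 1), snd Y))) (at ?Y0 within ?N)"
    proof (rule has_derivative_chain_within [where T = "exp_bundle \<times> {0..1}"])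
      show "((\<lambda>((q, w), t). L q w t) has_derivative D)
          (at ((fst (fst ?Y0), W (fst (fst ?Y0))), snd ?Y0) within exp_bundle \<times> {0..1})"
        using D by (simp add: W0)
      have "((\<lambda>Y. W (fst (fst Y))) has_derivative (\<lambda>Y. - expect (fst (fst Y)) w0 *\<^sub>R 1)) (at ?Y0 within ?N)"
        unfolding W_def exp_transport_eq
        by (rule derivative_eq_intros fst_fst
            bounded_linear.has_derivative [OF expect.bounded_linear_left] refl)+
           (auto simp: fun_eq_iff)
      then show "((\<lambda>Y. ((fst (fst Y), W (fst (fst Y))), snd Y)) has_derivative
          (\<lambda>Y. ((fst (fst Y), - expect (fst (fst Y)) w0 *\<^sub>R 1), snd Y))) (at ?Y0 within ?N)"
        by (intro has_derivative_Pair fst_fst snd')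
      show "(\<lambda>Y. ((fst (fst Y), W (fst (fst Y))), snd Y)) ` ?N \<subseteq> exp_bundle \<times> {0..1}"
        by (auto simp: exp_bundle_def mix_bundle_def W_in)
    qed
    moreover have "((\<lambda>Y. expect (snd (fst Y) * fst (fst Y)) w0) has_derivative
        (\<lambda>Y. expect (snd (fst Y) * q0 + \<eta>0 * fst (fst Y)) w0)) (at ?Y0 within ?N)"
      by (rule has_derivative_eq_rhs, rule bounded_linear.has_derivative [OF expect.bounded_linear_left])
         (rule vec_times.FDERIV [OF snd_fst fst_fst], simp add: add.commute)
    ultimately show ?thesis
      unfolding K_def [abs_def] by (simp add: has_derivative_diff)
  qed
  obtain R dR where R: "0 \<le> R" "0 < dR"
    "\<And>q \<eta> t. q \<in> densities \<Longrightarrow> \<eta> \<in> mix_fiber q \<Longrightarrow> t \<in> {0..1} \<Longrightarrow>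
       norm (((q, \<eta>), t) - ?Y0) < dR \<Longrightarrow>
       norm (legendre_inv q \<eta> t - w0) \<le> R * norm (((q, \<eta>), t) - ?Y0)"
    using legendre_inv_lipschitz_at [OF q0 \<eta>0 t0] unfolding w0_def by metis
  obtain BW where BW: "0 \<le> BW" "\<And>q. norm (W q - w0) \<le> BW * norm (q - q0)"
    using exp_transport_lipschitz_at [OF w0] unfolding W_def by metis
  obtain C where C: "0 \<le> C"
    "\<And>q \<eta> v :: real ^ 'n. norm (q - q0) \<le> 1 \<Longrightarrow> \<bar>pairing q \<eta> v\<bar> \<le> C * norm \<eta> * norm v"
    using pairing_bounded by metis
  have "((\<lambda>((q, \<eta>), t). hamiltonian L q \<eta> t) has_derivative
      (\<lambda>Y. expect (snd (fst Y) * q0 + \<eta>0 * fst (fst Y)) w0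
        - D ((fst (fst Y), - expect (fst (fst Y)) w0 *\<^sub>R 1), snd Y))) (at ?Y0 within ?N)"
  proof (rule has_derivative_perturb [OF K_deriv])
    show "?Y0 \<in> ?N"
      using q0 \<eta>0 t0 by (simp add: mix_bundle_def)
    fix e :: real assume e: "0 < e"
    define e' where "e' = e / (2 * (C * (R + BW) + 1))"
    have e': "0 < e'" "C * (2 * e') * (R + BW) \<le> e"
    proof -
      have "0 \<le> C * (R + BW)"
        using C(1) R(1) BW(1) by simp
      then show "0 < e'" "C * (2 * e') * (R + BW) \<le> e"
        using e by (auto simp: e'_def field_simps)
    qed
    have "((q0, w0), t0) \<in> exp_bundle \<times> {0..1}"
      using q0 w0 t0 by (simp add: exp_bundle_def)
    then obtain \<delta> where \<delta>: "0 < \<delta>"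
      "\<And>X. X \<in> exp_bundle \<times> {0..1} \<Longrightarrow> dist X ((q0, w0), t0) < \<delta> \<Longrightarrow>
        dist ((\<lambda>((q, w), t). fiber_grad_e L q w t) X)
          ((\<lambda>((q, w), t). fiber_grad_e L q w t) ((q0, w0), t0)) < e'"
      using fiber_grad_e_continuous_on e'(1) unfolding continuous_on_iff by metis
    define d0 where "d0 = min (min dR 1) (min e' (\<delta> / (3 + R + 2 * BW)))"
    have "0 < d0"
      using R BW e' \<delta> by (auto simp: d0_def)
    moreover have "norm ((\<lambda>((q, \<eta>), t). hamiltonian L q \<eta> t) Y - K Y) \<le> e * norm (Y - ?Y0)"
      if Y: "Y \<in> ?N" and less: "norm (Y - ?Y0) < d0" for Y
    proof -
      obtain q \<eta> t where Y_eq: "Y = ((q, \<eta>), t)"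
        by (metis surj_pair)
      have q: "q \<in> densities" and \<eta>: "\<eta> \<in> mix_fiber q" and t: "t \<in> {0..1}"
        using Y by (auto simp: Y_eq mix_bundle_def)
      define d where "d = norm (Y - ?Y0)"
      have d: "0 \<le> d" "d < dR" "d < 1" "d < e'" "(3 + R + 2 * BW) * d < \<delta>"
        using less R BW by (auto simp: d0_def d_def field_simps)
      have "norm ((q, \<eta>) - (q0, \<eta>0)) \<le> d" "norm (t - t0) \<le> d"
        unfolding d_def Y_eq by (metis diff_Pair norm_fst_le, metis diff_Pair norm_snd_le)
      then have qd: "norm (q - q0) \<le> d" and \<eta>d: "norm (\<eta> - \<eta>0) \<le> d" and td: "norm (t - t0) \<le> d"
        by (metis diff_Pair norm_fst_le order_trans, metis diff_Pair norm_snd_le order_trans, simp)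
      define w where "w = legendre_inv q \<eta> t"
      define \<beta> where "\<beta> = w - W q"
      have \<beta>_in: "\<beta> \<in> exp_fiber q"
        unfolding \<beta>_def w_def
        by (intro subspace_diff exp_fiber_subspace legendre_inv_in_fiber W_in q \<eta> t)
      have Wd: "norm (W q - w0) \<le> BW * d"
        using BW(2) [of q] mult_left_mono [OF qd BW(1)] by simp
      have wd: "norm (w - w0) \<le> R * d"
        using R(3) [OF q \<eta> t] d(2) by (simp add: w_def d_def Y_eq)
      have \<beta>d: "norm \<beta> \<le> (R + BW) * d"
        using norm_triangle_ineq4 [of "w - w0" "W q - w0"] wd Wd by (simp add: \<beta>_def algebra_simps)
      \<comment> \<open>Transport changes \<open>w0\<close> by a constant, which has no effect when paired with \<open>\<eta>\<close>.\<close>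
      have "pairing q \<eta> (W q) = expect (\<eta> * q) w0"
        using expect_mix_fiber_times_one [OF \<eta>]
        by (simp add: pairing_eq_expect W_def exp_transport_eq expect.diff_right expect.scaleR_right)
      moreover obtain s where s: "0 < s" "s < 1"
        "(pairing q \<eta> (W q + \<beta>) - L q (W q + \<beta>) t) - (pairing q \<eta> (W q) - L q (W q) t) =
          pairing q (\<eta> - fiber_grad_e L q (W q + s *\<^sub>R \<beta>) t) \<beta>"
        using legendre_defect_mean_value [OF q W_in [OF q] \<beta>_in t] by metis
      ultimately have "\<bar>hamiltonian L q \<eta> t - K Y\<bar> =
          \<bar>pairing q (\<eta> - fiber_grad_e L q (W q + s *\<^sub>R \<beta>) t) \<beta>\<bar>"
        by (simp add: hamiltonian_eq K_def Y_eq \<beta>_def w_def)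
      also have "\<dots> \<le> C * norm (\<eta> - fiber_grad_e L q (W q + s *\<^sub>R \<beta>) t) * norm \<beta>"
        using qd d(3) by (intro C(2)) simp
      also have "\<dots> \<le> C * (2 * e') * ((R + BW) * d)"
      proof (intro mult_mono order_refl C(1) \<beta>d)
        let ?w = "W q + s *\<^sub>R \<beta>"
        have "?w \<in> exp_fiber q"
          using W_in [OF q] \<beta>_in by (intro subspace_add subspace_scale exp_fiber_subspace)
        have "norm (?w - w0) \<le> norm (W q - w0) + norm (s *\<^sub>R \<beta>)"
          using norm_triangle_ineq [of "W q - w0" "s *\<^sub>R \<beta>"] by (simp add: algebra_simps)
        also have "norm (s *\<^sub>R \<beta>) \<le> norm \<beta>"
          using s(1,2) mult_right_mono [of s 1 "norm \<beta>"] by simp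
        finally have wsd: "norm (?w - w0) \<le> (R + 2 * BW) * d"
          using Wd \<beta>d by (simp add: algebra_simps)
        have "norm (((q, ?w), t) - ((q0, w0), t0)) \<le> norm (q - q0, ?w - w0) + norm (t - t0)"
          using norm_Pair_le [of "(q - q0, ?w - w0)" "t - t0"] by simp
        also have "\<dots> \<le> norm (q - q0) + norm (?w - w0) + norm (t - t0)"
          by (simp add: norm_Pair_le)
        also have "\<dots> \<le> (3 + R + 2 * BW) * d"
          using qd wsd td d(1) by (simp add: algebra_simps)
        also note d(5)
        finally have "norm (fiber_grad_e L q ?w t - \<eta>0) < e'"
          using \<delta>(2) [of "((q, ?w), t)"] \<open>?w \<in> exp_fiber q\<close> q t
          by (simp add: exp_bundle_def F0 dist_norm)
        then show "norm (\<eta> - fiber_grad_e L q ?w t) \<le> 2 * e'"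
          using norm_triangle_ineq4 [of "\<eta> - \<eta>0" "fiber_grad_e L q ?w t - \<eta>0"] \<eta>d d(4) by simp
      qed (use C(1) e'(1) in auto)
      also have "\<dots> = (C * (2 * e') * (R + BW)) * d"
        by simp
      also have "\<dots> \<le> e * d"
        using e'(2) d(1) by (rule mult_right_mono)
      finally show ?thesis
        by (simp add: d_def Y_eq)
    qed
    ultimately show "\<exists>d>0. \<forall>Y\<in>?N. norm (Y - ?Y0) < d \<longrightarrow>
        norm ((\<lambda>((q, \<eta>), t). hamiltonian L q \<eta> t) Y - K Y) \<le> e * norm (Y - ?Y0)"
      by blast
  qed
  then show ?thesis
    by (simp add: case_prod_unfold)
qed

section \<open>The gradients of the Hamiltonian\<close>

lemma is_fiber_grad_m_hamiltonian:
  assumes q: "q \<in> densities" and \<eta>: "\<eta> \<in> mix_fiber q" and t: "t \<in> {0..1}"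
  shows "is_fiber_grad_m (hamiltonian L) q \<eta> t (legendre_inv q \<eta> t)"
  unfolding is_fiber_grad_m_def
proof (intro conjI ballI)
  let ?w = "legendre_inv q \<eta> t"
  show w: "?w \<in> exp_fiber q"
    using q \<eta> t by (rule legendre_inv_in_fiber)
  fix \<alpha> assume \<alpha>: "\<alpha> \<in> mix_fiber q"
  obtain D where D: "has_L_derivative D q ?w t"
    using L_derivative_exists [OF q w t] .
  interpret D: bounded_linear D
    using D by (rule has_derivative_bounded_linear)
  let ?DH = "\<lambda>((a, b), \<tau>). expect (b * q + \<eta> * a) ?w - D ((a, - expect a ?w *\<^sub>R 1), \<tau>)"
  have "((\<lambda>s. (\<lambda>((q, \<eta>), t). hamiltonian L q \<eta> t) ((q, \<eta> + s *\<^sub>R \<alpha>), t)) has_derivative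
      (\<lambda>s. ?DH ((0, s *\<^sub>R \<alpha>), 0))) (at 0)"
  proof (rule has_derivative_chain_within [where T = "mix_bundle \<times> {0..1}"])
    show "((\<lambda>((q, \<eta>), t). hamiltonian L q \<eta> t) has_derivative ?DH)
        (at ((q, \<eta> + 0 *\<^sub>R \<alpha>), t) within mix_bundle \<times> {0..1})"
      using hamiltonian_has_derivative [OF q \<eta> t refl D] by simp
    show "((\<lambda>s. ((q, \<eta> + s *\<^sub>R \<alpha>), t)) has_derivative (\<lambda>s. ((0, s *\<^sub>R \<alpha>), 0))) (at 0)"
      by (auto intro!: derivative_eq_intros)
    show "range (\<lambda>s. ((q, \<eta> + s *\<^sub>R \<alpha>), t)) \<subseteq> mix_bundle \<times> {0..1}"
      using q t \<eta> \<alpha> exp_fiber_subspace [of q]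
      by (auto simp: mix_bundle_def mix_fiber_eq_exp_fiber intro: subspace_add subspace_scale)
  qed
  moreover have "?DH ((0, s *\<^sub>R \<alpha>), 0) = pairing q \<alpha> ?w * s" for s
    using D.zero by (simp add: pairing_eq_expect vec_times.zero_right vec_times.scaleR_left
        expect.zero_left expect.scaleR_left zero_prod_def)
  ultimately show "((\<lambda>s. hamiltonian L q (\<eta> + s *\<^sub>R \<alpha>) t) has_real_derivative pairing q \<alpha> ?w) (at 0)"
    by (simp add: has_field_derivative_def)
qed

lemma fiber_grad_m_hamiltonian:
  assumes q: "q \<in> densities" and \<eta>: "\<eta> \<in> mix_fiber q" and t: "t \<in> {0..1}"
  shows "fiber_grad_m (hamiltonian L) q \<eta> t = legendre_inv q \<eta> t"
proof -
  have "g = g'" if "is_fiber_grad_m (hamiltonian L) q \<eta> t g" "is_fiber_grad_m (hamiltonian L) q \<eta> t g'"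
    for g g'
  proof (rule pairing_eq_imp_eq [OF q])
    fix h assume "h \<in> exp_fiber q"
    then have "pairing q h g = pairing q h g'"
      using that by (auto simp: is_fiber_grad_m_def mix_fiber_eq_exp_fiber intro: DERIV_unique)
    then show "pairing q g h = pairing q g' h"
      by (simp add: pairing_def mult.commute)
  qed (use that in \<open>auto simp: is_fiber_grad_m_def mix_fiber_eq_exp_fiber\<close>)
  with is_fiber_grad_m_hamiltonian [OF assms] show ?thesis
    unfolding fiber_grad_m_def by blast
qed

text \<open>
  Under mixture transport the pairing term of the Hamiltonian stays constant to first order, and what
  is left of the differential is the variation of \<open>- L\<close> with transported velocity.
\<close>

lemma is_grad_mix_hamiltonian:
  assumes q: "q \<in> densities" and \<eta>: "\<eta> \<in> mix_fiber q" and t: "t \<in> {0..1}"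
  shows "is_grad_mix (hamiltonian L) q \<eta> t (- grad_exp L q (legendre_inv q \<eta> t) t)"
  unfolding is_grad_mix_def
proof (intro conjI ballI impI)
  let ?w = "legendre_inv q \<eta> t"
  have w: "?w \<in> exp_fiber q"
    using q \<eta> t by (rule legendre_inv_in_fiber)
  obtain D where D: "has_L_derivative D q ?w t"
    using L_derivative_exists [OF q w t] .
  interpret D: bounded_linear D
    using D by (rule has_derivative_bounded_linear)
  show "- grad_exp L q ?w t \<in> mix_fiber q"
    using grad_exp_in_fiber [OF q w t]
    by (simp add: mix_fiber_eq_exp_fiber subspace_neg exp_fiber_subspace)
  fix p u \<zeta>
  assume p: "p \<in> densities" and u: "u \<in> exp_fiber p" and \<zeta>: "\<zeta> \<in> mix_fiber p"
    and qu: "q = exp_chart_inv p u" and \<eta>\<zeta>: "\<eta> = mix_transport p q \<zeta>"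
  let ?a = "\<lambda>k. exp_transport p q k * q"
  have a: "(exp_chart_inv p has_derivative ?a) (at u within exp_fiber p)"
    using exp_chart_inv_has_derivative [OF p, of u] by (simp add: qu)
  obtain b where b: "((\<lambda>u'. mix_transport p (exp_chart_inv p u') \<zeta>) has_derivative b)
      (at u within exp_fiber p)" and ba: "\<And>k. b k * q + \<eta> * ?a k = 0"
    using mix_transport_has_derivative [OF a, of p \<zeta>] densities_nonzero [OF q]
    by (metis qu \<eta>\<zeta>)
  let ?DH = "\<lambda>((a, b), \<tau>). expect (b * q + \<eta> * a) ?w - D ((a, - expect a ?w *\<^sub>R 1), \<tau>)"
  have "((\<lambda>u'. (\<lambda>((q, \<eta>), t). hamiltonian L q \<eta> t)
      ((exp_chart_inv p u', mix_transport p (exp_chart_inv p u') \<zeta>), t)) has_derivative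
      (\<lambda>k. ?DH ((?a k, b k), 0))) (at u within exp_fiber p)"
  proof (rule has_derivative_chain_within [where T = "mix_bundle \<times> {0..1}"])
    show "((\<lambda>((q, \<eta>), t). hamiltonian L q \<eta> t) has_derivative ?DH)
        (at ((exp_chart_inv p u, mix_transport p (exp_chart_inv p u) \<zeta>), t)
          within mix_bundle \<times> {0..1})"
      using hamiltonian_has_derivative [OF q \<eta> t refl D] by (simp add: qu [symmetric] \<eta>\<zeta> [symmetric])
    show "((\<lambda>u'. ((exp_chart_inv p u', mix_transport p (exp_chart_inv p u') \<zeta>), t)) has_derivative
        (\<lambda>k. ((?a k, b k), 0))) (at u within exp_fiber p)"
      by (intro has_derivative_Pair a b has_derivative_const)
    show "(\<lambda>u'. ((exp_chart_inv p u', mix_transport p (exp_chart_inv p u') \<zeta>), t)) ` exp_fiber p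
        \<subseteq> mix_bundle \<times> {0..1}"
      using t p \<zeta> by (auto simp: mix_bundle_def exp_chart_inv_in_densities mix_transport_in_fiber)
  qed
  moreover have "?DH ((?a k, b k), 0) = - D ((?a k, - expect (?a k) ?w *\<^sub>R 1), 0)" for k
    using ba [of k] by (simp add: expect.zero_left)
  ultimately have "((\<lambda>u'. hamiltonian L (exp_chart_inv p u') (mix_transport p (exp_chart_inv p u') \<zeta>) t)
      has_derivative (\<lambda>k. - D ((?a k, - expect (?a k) ?w *\<^sub>R 1), 0))) (at u within exp_fiber p)"
    by simp
  moreover have "pairing q (- grad_exp L q ?w t) h =
      - D ((?a (exp_transport q p h), - expect (?a (exp_transport q p h)) ?w *\<^sub>R 1), 0)"
    if h: "h \<in> exp_fiber q" for h
  proof -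
    have "pairing q (- grad_exp L q ?w t) h = - pairing q (grad_exp L q ?w t) h"
      by (simp add: pairing_eq_expect vec_times.minus_left expect.minus_left)
    then show ?thesis
      using pairing_grad_exp [OF q w t D h] exp_transport_cancel [OF q h, of p] by simp
  qed
  ultimately show "\<exists>D. ((\<lambda>u'. hamiltonian L (exp_chart_inv p u') (mix_transport p (exp_chart_inv p u') \<zeta>) t)
      has_derivative D) (at u within exp_fiber p) \<and>
      (\<forall>h\<in>exp_fiber q. pairing q (- grad_exp L q ?w t) h = D (exp_transport q p h))"
    by (intro exI [of _ "\<lambda>k. - D ((?a k, - expect (?a k) ?w *\<^sub>R 1), 0)"]) simp
qed

lemma grad_mix_hamiltonian:
  assumes q: "q \<in> densities" and \<eta>: "\<eta> \<in> mix_fiber q" and t: "t \<in> {0..1}"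
  shows "grad_mix (hamiltonian L) q \<eta> t = - grad_exp L q (legendre_inv q \<eta> t) t"
  unfolding grad_mix_def
  using is_grad_mix_hamiltonian [OF assms] is_grad_mix_unique [OF q \<eta>] by blast

lemma hamiltonian_partial_time_derivative:
  assumes q: "q \<in> densities" and \<eta>: "\<eta> \<in> mix_fiber q" and t: "t \<in> {0..1}"
    and D: "has_L_derivative D q (legendre_inv q \<eta> t) t"
  shows "((\<lambda>s. hamiltonian L q \<eta> s) has_real_derivative - D (0, 1)) (at t within {0..1})"
proof -
  interpret D: bounded_linear D
    using D by (rule has_derivative_bounded_linear)
  let ?w = "legendre_inv q \<eta> t"
  let ?DH = "\<lambda>((a, b), \<tau>). expect (b * q + \<eta> * a) ?w - D ((a, - expect a ?w *\<^sub>R 1), \<tau>)"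
  have "((\<lambda>s. (\<lambda>((q, \<eta>), t). hamiltonian L q \<eta> t) ((q, \<eta>), s)) has_derivative
      (\<lambda>s. ?DH ((0, 0), s))) (at t within {0..1})"
  proof (rule has_derivative_chain_within [where T = "mix_bundle \<times> {0..1}"])
    show "((\<lambda>((q, \<eta>), t). hamiltonian L q \<eta> t) has_derivative ?DH)
        (at ((q, \<eta>), t) within mix_bundle \<times> {0..1})"
      using hamiltonian_has_derivative [OF q \<eta> t refl D] .
    show "((\<lambda>s. ((q, \<eta>), s)) has_derivative (\<lambda>s. ((0, 0), s))) (at t within {0..1})"
      by (auto intro!: derivative_eq_intros simp: zero_prod_def)
    show "(\<lambda>s. ((q, \<eta>), s)) ` {0..1} \<subseteq> mix_bundle \<times> {0..1}"
      using q \<eta> by (auto simp: mix_bundle_def)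
  qed
  moreover have "?DH ((0, 0), s) = - D (0, 1) * s" for s
    using D.scaleR [of s "(0, 1)"]
    by (simp add: vec_times.zero_left vec_times.zero_right expect.zero_left zero_prod_def)
  ultimately have "((\<lambda>s. hamiltonian L q \<eta> s) has_derivative (\<lambda>s. - D (0, 1) * s)) (at t within {0..1})"
    by simp
  then show ?thesis
    by (simp only: has_field_derivative_def)
qed

end

section \<open>Curves of densities\<close>

lemma interval_at_within_nontrivial:
  fixes J :: "real set"
  assumes "is_interval J" "interior J \<noteq> {}" "t \<in> J"
  shows "at t within J \<noteq> bot"
proof -
  have "J \<noteq> {t}"
    using assms(2) by auto
  then have "t islimpt J"
    using assms by (intro connected_imp_perfect is_interval_connected) auto
  then show ?thesis
    by (simp add: trivial_limit_within)
qed

lemma velocity_times: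
  assumes "(q has_vector_derivative q') (at t within J)" "at t within J \<noteq> bot" "q t \<in> densities"
  shows "velocity J q t * q t = q'"
  using vector_derivative_within [OF assms(2,1)] densities_nonzero [OF assms(3)]
  by (simp add: velocity_def vec_eq_iff)

lemma mix_covariant_derivative_times:
  assumes q: "(q has_vector_derivative q') (at t within J)"
    and \<eta>: "(\<eta> has_vector_derivative \<eta>') (at t within J)"
    and nontriv: "at t within J \<noteq> bot" and dens: "q t \<in> densities"
  shows "mix_covariant_derivative J q \<eta> t * q t = \<eta>' * q t + \<eta> t * q'"
proof -
  have "(velocity J q t * \<eta> t) * q t = \<eta> t * q'"
    using velocity_times [OF q nontriv dens] by (simp add: vec_eq_iff mult_ac)
  moreover have "mix_covariant_derivative J q \<eta> t = velocity J q t * \<eta> t + \<eta>'"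
    using vector_derivative_within [OF nontriv \<eta>]
    by (simp add: mix_covariant_derivative_def vec_eq_iff)
  ultimately show ?thesis
    by (simp add: vec_times.add_left)
qed

lemma velocity_in_fiber:
  assumes q: "(q has_vector_derivative q') (at t within J)" and nontriv: "at t within J \<noteq> bot"
    and dens: "\<And>s. s \<in> J \<Longrightarrow> q s \<in> densities" and t: "t \<in> J"
  shows "velocity J q t \<in> exp_fiber (q t)"
proof -
  have "((\<lambda>s. expect (q s) 1) has_vector_derivative expect q' 1) (at t within J)"
    using q by (rule bounded_linear.has_vector_derivative [OF expect.bounded_linear_left])
  then have "((\<lambda>s. 1) has_vector_derivative expect q' 1) (at t within J)"
    by (rule has_vector_derivative_transform [OF t, rotated]) (simp add: expect_one dens)
  then have "expect q' 1 = 0"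
    by (rule vector_derivative_unique_within [OF nontriv]) simp
  moreover have "expect (q t) (velocity J q t) = expect (velocity J q t * q t) 1"
    by (simp add: expect_times_move expect_commute [of "q t"])
  ultimately show ?thesis
    using velocity_times [OF q nontriv dens [OF t]] by (simp add: exp_fiber_def)
qed

text \<open>
  On the interval, including its end points, the time derivative within the interval is the
  derivative of a local smooth extension and hence differentiable in time.
\<close>

lemma velocity_differentiable:
  fixes q :: "real \<Rightarrow> real ^ 'n::finite"
  assumes smooth: "smooth_on J q" and J: "is_interval J" "interior J \<noteq> {}" and t: "t \<in> J"
    and dens: "q t \<in> densities"
  shows "velocity J q differentiable (at t within J)"
proof -
  obtain U g where U: "open U" "t \<in> U" and "\<forall>k. Ck_on k g U" and g_eq: "\<forall>s\<in>J \<inter> U. q s = g s"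
    using smooth t unfolding smooth_on_def by meson
  then have "Ck_on 2 g U"
    by blast
  then have g1: "\<And>s. s \<in> U \<Longrightarrow> g differentiable at s"
    and g2: "\<And>s v. s \<in> U \<Longrightarrow> (\<lambda>s. frechet_derivative g (at s) v) differentiable at s"
    by (auto simp: numeral_2_eq_2)
  have vd: "vector_derivative q (at s within J) = frechet_derivative g (at s) 1" if s: "s \<in> J" "s \<in> U" for s
  proof (rule vector_derivative_within [OF interval_at_within_nontrivial [OF J s(1)]])
    have "(g has_derivative frechet_derivative g (at s)) (at s within J)"
      using g1 [OF s(2)] by (simp add: frechet_derivative_works has_derivative_at_withinI)
    then have q_deriv: "(q has_derivative frechet_derivative g (at s)) (at s within J)"
      by (rule has_derivative_transform_Int [OF _ U(1) s(2,1) g_eq])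
    have "frechet_derivative g (at s) r = r *\<^sub>R frechet_derivative g (at s) 1" for r
      using linear_cmul [OF linear_frechet_derivative [OF g1 [OF s(2)]], of r 1] by simp
    then show "(q has_vector_derivative frechet_derivative g (at s) 1) (at s within J)"
      unfolding has_vector_derivative_def by (intro has_derivative_eq_rhs [OF q_deriv] ext)
  qed
  show ?thesis
  proof (rule differentiable_vecI)
    fix x
    have comp: "(\<lambda>s. f s $ x) differentiable (at t within J)" if "f differentiable (at t within J)"
      for f :: "real \<Rightarrow> real ^ 'n"
      using that bounded_linear.has_derivative [OF bounded_linear_vec_nth]
      unfolding differentiable_def by blast
    have "q differentiable (at t within J)"
      using smooth_on_has_derivative [OF smooth t] by (auto simp: differentiable_def)
    then have "(\<lambda>s. frechet_derivative g (at s) 1 $ x / q s $ x) differentiable (at t within J)"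
      using densities_nonzero [OF dens]
      by (intro differentiable_divide comp differentiable_at_withinI [OF g2 [OF U(2)]])
    then obtain D where "((\<lambda>s. frechet_derivative g (at s) 1 $ x / q s $ x) has_derivative D) (at t within J)"
      by (auto simp: differentiable_def)
    then have "((\<lambda>s. velocity J q s $ x) has_derivative D) (at t within J)"
      by (rule has_derivative_transform_Int [OF _ U t]) (simp add: velocity_def vd)
    then show "(\<lambda>s. velocity J q s $ x) differentiable (at t within J)"
      by (auto simp: differentiable_def)
  qed
qed

section \<open>Hamilton equations\<close>

theorem proposition5p3:
  fixes L H :: "real ^ 'n::finite \<Rightarrow> real ^ 'n \<Rightarrow> real \<Rightarrow> real"
    and q \<eta> :: "real \<Rightarrow> real ^ 'n"
    and J :: "real set"
  assumes L_smooth: "smooth_on (exp_bundle \<times> {0..1}) (\<lambda>((q, w), t). L q w t)"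
    and fiber_bij: "\<And>q t. q \<in> densities \<Longrightarrow> t \<in> {0..1} \<Longrightarrow>
          bij_betw (\<lambda>w. fiber_grad_e L q w t) (exp_fiber q) (mix_fiber q)"
    and legendre_diffeo: "\<And>t. t \<in> {0..1} \<Longrightarrow>
          diffeomorphism_on exp_bundle mix_bundle (\<lambda>(q, w). (q, fiber_grad_e L q w t))"
    and H_def: "H = hamiltonian L"
    and J: "is_interval J" "interior J \<noteq> {}" "J \<subseteq> {0..1}"
    and q_densities: "\<And>t. t \<in> J \<Longrightarrow> q t \<in> densities"
    and q_smooth: "smooth_on J q"
    and momentum: "\<And>t. t \<in> J \<Longrightarrow> \<eta> t = fiber_grad_e L (q t) (velocity J q t) t"
    and euler_lagrange: "\<And>t. t \<in> J \<Longrightarrow>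
          mix_covariant_derivative J q (\<lambda>t. fiber_grad_e L (q t) (velocity J q t) t) t =
          grad_exp L (q t) (velocity J q t) t"
  shows "\<forall>t\<in>J.
      \<comment> \<open>the momentum curve lies in the mixture bundle and all derivatives below exist\<close>
      (q t, \<eta> t) \<in> mix_bundle \<and>
      \<eta> differentiable (at t within J) \<and>
      is_grad_mix H (q t) (\<eta> t) t (grad_mix H (q t) (\<eta> t) t) \<and>
      is_fiber_grad_m H (q t) (\<eta> t) t (fiber_grad_m H (q t) (\<eta> t) t) \<and>
      \<comment> \<open>Hamilton equations\<close>
      mix_covariant_derivative J q \<eta> t = - grad_mix H (q t) (\<eta> t) t \<and>
      velocity J q t = fiber_grad_m H (q t) (\<eta> t) t \<and>
      \<comment> \<open>total and partial time derivative of the Hamiltonian along the curve coincide\<close>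
      (\<exists>d. ((\<lambda>s. H (q s) (\<eta> s) s) has_real_derivative d) (at t within J) \<and>
           ((\<lambda>s. H (q t) (\<eta> t) s) has_real_derivative d) (at t within {0..1}))"
proof
  fix t assume t: "t \<in> J"
  interpret hyperregular_lagrangian L
    using L_smooth fiber_bij legendre_diffeo by unfold_locales
  have nontriv: "at t within J \<noteq> bot"
    using interval_at_within_nontrivial [OF J(1,2) t] .
  have t01: "t \<in> {0..1}"
    using J(3) t by auto
  let ?w = "velocity J q"
  have dq: "\<exists>q'. (q has_vector_derivative q') (at s within J)" if "s \<in> J" for s
    using smooth_on_has_derivative [OF q_smooth that]
    by (metis differentiable_def vector_derivative_works)
  have w_in: "?w s \<in> exp_fiber (q s)" if s: "s \<in> J" for s
  proof -
    obtain q' where "(q has_vector_derivative q') (at s within J)"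
      using dq [OF s] by blast
    from velocity_in_fiber [OF this interval_at_within_nontrivial [OF J(1,2) s] q_densities s]
    show ?thesis .
  qed
  have curve: "((q s, ?w s), s) \<in> exp_bundle \<times> {0..1}" if "s \<in> J" for s
    using q_densities w_in J(3) that by (auto simp: exp_bundle_def)
  have \<eta>_in: "\<eta> s \<in> mix_fiber (q s)" if "s \<in> J" for s
    using momentum [OF that] fiber_grad_e_in_fiber [of "q s" "?w s" s] curve [OF that]
    by (simp add: exp_bundle_def)
  obtain q' where q': "(q has_vector_derivative q') (at t within J)"
    using dq [OF t] by blast
  obtain w' where w': "(?w has_derivative w') (at t within J)"
    using velocity_differentiable [OF q_smooth J(1,2) t q_densities [OF t]]
    by (auto simp: differentiable_def)
  obtain DF where DF: "((\<lambda>((q, w), t). fiber_grad_e L q w t) has_derivative DF)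
      (at ((q t, ?w t), t) within exp_bundle \<times> {0..1})"
    using fiber_grad_e_differentiable [OF curve [OF t]] by (auto simp: differentiable_def)
  have "((\<lambda>s. (\<lambda>((q, w), t). fiber_grad_e L q w t) ((q s, ?w s), s)) has_derivative
      (\<lambda>r. DF ((r *\<^sub>R q', w' r), r))) (at t within J)"
    using q' curve unfolding has_vector_derivative_def
    by (intro has_derivative_chain_within [where f = "\<lambda>s. ((q s, ?w s), s)" and x = t, OF DF]
          has_derivative_Pair w') auto
  then have "(\<lambda>s. fiber_grad_e L (q s) (?w s) s) differentiable (at t within J)"
    by (auto simp: differentiable_def)
  then obtain \<eta>' where F': "((\<lambda>s. fiber_grad_e L (q s) (?w s) s) has_vector_derivative \<eta>') (at t within J)"
    by (metis vector_derivative_works)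
  then have \<eta>': "(\<eta> has_vector_derivative \<eta>') (at t within J)"
    by (rule has_vector_derivative_transform [OF t momentum, rotated])
  have el: "mix_covariant_derivative J q \<eta> t = grad_exp L (q t) (?w t) t"
    using euler_lagrange [OF t] vector_derivative_within [OF nontriv F']
      vector_derivative_within [OF nontriv \<eta>'] momentum [OF t]
    by (simp add: mix_covariant_derivative_def)
  have w_eq: "legendre_inv (q t) (\<eta> t) t = ?w t"
    using legendre_inv_fiber_grad_e [OF q_densities w_in t01] t by (simp add: momentum)
  note at_t = q_densities [OF t] \<eta>_in [OF t] t01
  obtain D where D: "has_L_derivative D (q t) (?w t) t"
    using L_derivative_exists [OF q_densities [OF t] w_in [OF t] t01] .
  interpret D: bounded_linear D
    using D by (rule has_derivative_bounded_linear)
  let ?DH = "\<lambda>((a, b), \<tau>). expect (b * q t + \<eta> t * a) (?w t) - D ((a, - expect a (?w t) *\<^sub>R 1), \<tau>)"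
  have "((\<lambda>s. (\<lambda>((q, \<eta>), t). hamiltonian L q \<eta> t) ((q s, \<eta> s), s)) has_derivative
      (\<lambda>r. ?DH ((r *\<^sub>R q', r *\<^sub>R \<eta>'), r))) (at t within J)"
    using q' \<eta>' q_densities \<eta>_in J(3) unfolding has_vector_derivative_def
    by (intro has_derivative_chain_within [where f = "\<lambda>s. ((q s, \<eta> s), s)" and x = t, OF hamiltonian_has_derivative [OF at_t w_eq [symmetric] D]]
          has_derivative_Pair) (auto simp: mix_bundle_def)
  moreover have "?DH ((r *\<^sub>R q', r *\<^sub>R \<eta>'), r) = - D (0, 1) * r" for r
  proof -
    \<comment> \<open>The Euler--Lagrange equation paired with the velocity: the pairing term of the differential of
        \<open>H\<close> cancels the variation of \<open>L\<close> in the direction of the curve.\<close>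
    have "expect (\<eta>' * q t + \<eta> t * q') (?w t) = pairing (q t) (grad_exp L (q t) (?w t) t) (?w t)"
      using mix_covariant_derivative_times [OF q' \<eta>' nontriv q_densities [OF t]]
      by (simp add: el pairing_eq_expect)
    also have "\<dots> = D ((q', - expect q' (?w t) *\<^sub>R 1), 0)"
      using pairing_grad_exp [OF q_densities [OF t] w_in [OF t] t01 D w_in [OF t]]
        velocity_times [OF q' nontriv q_densities [OF t]] by simp
    finally have "expect (\<eta>' * q t + \<eta> t * q') (?w t) - D ((q', - expect q' (?w t) *\<^sub>R 1), 1) =
        - D (0, 1)"
      using D.add [of "((q', - expect q' (?w t) *\<^sub>R 1), 0)" "(0, 1)"] by simp
    moreover have "?DH ((r *\<^sub>R q', r *\<^sub>R \<eta>'), r) = r *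
        (expect (\<eta>' * q t + \<eta> t * q') (?w t) - D ((q', - expect q' (?w t) *\<^sub>R 1), 1))"
      using D.scaleR [of r "((q', - expect q' (?w t) *\<^sub>R 1), 1)"]
      by (simp add: vec_times.scaleR_left vec_times.scaleR_right expect.scaleR_left expect.add_left
          algebra_simps)
    ultimately show ?thesis
      by simp
  qed
  ultimately have "((\<lambda>s. hamiltonian L (q s) (\<eta> s) s) has_derivative (\<lambda>r. - D (0, 1) * r)) (at t within J)"
    by simp
  then have "((\<lambda>s. hamiltonian L (q s) (\<eta> s) s) has_real_derivative - D (0, 1)) (at t within J)"
    by (simp only: has_field_derivative_def)
  moreover have "((\<lambda>s. hamiltonian L (q t) (\<eta> t) s) has_real_derivative - D (0, 1)) (at t within {0..1})"
    using hamiltonian_partial_time_derivative [OF at_t, of D] D by (simp add: w_eq)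
  moreover have "\<eta> differentiable (at t within J)"
    using \<eta>' unfolding has_vector_derivative_def differentiable_def by blast
  ultimately show "(q t, \<eta> t) \<in> mix_bundle \<and>
      \<eta> differentiable (at t within J) \<and>
      is_grad_mix H (q t) (\<eta> t) t (grad_mix H (q t) (\<eta> t) t) \<and>
      is_fiber_grad_m H (q t) (\<eta> t) t (fiber_grad_m H (q t) (\<eta> t) t) \<and>
      mix_covariant_derivative J q \<eta> t = - grad_mix H (q t) (\<eta> t) t \<and>
      velocity J q t = fiber_grad_m H (q t) (\<eta> t) t \<and>
      (\<exists>d. ((\<lambda>s. H (q s) (\<eta> s) s) has_real_derivative d) (at t within J) \<and>
           ((\<lambda>s. H (q t) (\<eta> t) s) has_real_derivative d) (at t within {0..1}))"
    unfolding H_def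
    using at_t is_grad_mix_hamiltonian [OF at_t] is_fiber_grad_m_hamiltonian [OF at_t]
    by (auto simp: mix_bundle_def grad_mix_hamiltonian [OF at_t] fiber_grad_m_hamiltonian [OF at_t]
        w_eq el)
qed

end
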